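(* Let $M$ be a lattice of rank $n$ and $\mathcal{A}_0,\dots,\mathcal{A}_n$ nonempty finite subsets of $M$, with $\Delta_i=\operatorname{conv}(\mathcal{A}_i)$ and $\Delta=\sum_{i=0}^n\Delta_i$. For $i=0,\dots,n-1$ set $\mathcal{A}_{>i}=\sum_{j>i}\mathcal{A}_j\subset M$ and let $W'_i\subset\mathbb{R}^{\mathcal{A}_0}\times\dots\times\mathbb{R}^{\mathcal{A}_i}$ be a finite union of hyperplanes such that for all $(\boldsymbol{\nu}'_0,\dots,\boldsymbol{\nu}'_i)\notin W'_i$ the mixed subdivision $S(\Theta_{(\boldsymbol{\nu}'_0,\dots,\boldsymbol{\nu}'_i,\boldsymbol{0})})$ of $\Delta$ associated to the $i+2$ supports $(\mathcal{A}_0,\dots,\mathcal{A}_i,\mathcal{A}_{>i})$ is tight. For $i=0,\dots,n-1$ choose iteratively $\boldsymbol{\nu}_i\in\mathbb{R}^{\mathcal{A}_i}$ such that $(\boldsymbol{\nu}_0,\dots,\boldsymbol{\nu}_i)\notin W'_i$ and such that $(\boldsymbol{\nu}_0,\dots,\boldsymbol{\nu}_{i-1},\boldsymbol{\nu}_i,\boldsymbol{0},\dots,\boldsymbol{0})\in\prod_{j=0}^n\mathbb{R}^{\mathcal{A}_j}$ lies in a neighborhood $U_i$ of the point $p_i=(\boldsymbol{\nu}_0,\dots,\boldsymbol{\nu}_{i-1},\boldsymbol{0},\boldsymbol{0},\dots,\boldsymbol{0})$ with the property that $S(\Theta_{\widetilde{\boldsymbol{\nu}}})\succeq S(\Theta_{p_i})$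 for all $\widetilde{\boldsymbol{\nu}}\in U_i$. For $k=0,\dots,n$ set $\theta_{k,i}=\vartheta_{\boldsymbol{\nu}_i}$ if $i<k$ and $\theta_{k,i}=0|_{\Delta_i}$ if $i\ge k$, and $\theta_k=\boxplus_{i=0}^n\theta_{k,i}$. Then $S(\theta_0)\preceq\dots\preceq S(\theta_n)$ is an incremental chain of mixed subdivisions of $\Delta$ that is admissible for $S(\theta_n)$.
   Context: Polyhedral notation. $M\simeq\mathbb{Z}^n$, $N=\operatorname{Hom}(M,\mathbb{Z})$, $M_{\mathbb{R}}=M\otimes\mathbb{R}$, $N_{\mathbb{R}}=N\otimes\mathbb{R}$. For a convex piecewise affine function $\rho\colon\Delta\to\mathbb{R}$ on a polytope and $v\in N_{\mathbb{R}}$ put $\Gamma(\rho,v)=\{x\in\Delta\mid \rho(x)+\langle v,x\rangle=\min_{y\in\Delta}(\rho(y)+\langle v,y\rangle)\}$. The subdivision $S(\rho)$ of $\Delta$ is the collection of all the sets $\Gamma(\rho,v)$, called cells; an $n$-cell is a cell of dimension $n$. For a family $\rho_i\colon\Delta_i\to\mathbb{R}$, $i=0,\dots,s$, of convex piecewise affine functions on polytopes, the inf-convolution is $\rho=\boxplus_i\rho_i\colon\Delta=\sum_i\Delta_i\to\mathbb{R}$, $\rho(x)=\inf\{\sum_i\rho_i(x_i)\mid x_i\in\Delta_i,\sum_ix_i=x\}$, and $S(\rho)$ is called a mixed subdivision of $\Delta$. The $i$-th component of $C\in S(\rho)$ is the set $C_i$ of $x_i\in\Delta_i$ for which there are $x_j\in\Delta_j$,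 $j\ne i$, with $\sum_jx_j\in C$ and $\rho(\sum_jx_j)=\sum_j\rho_j(x_j)$; if $C=\Gamma(\rho,v)$ then $C_i=\Gamma(\rho_i,v)$. $S(\rho)$ is tight if $\sum_{i=0}^s\dim(C_i)=n$ for every $n$-cell $C$; in this case, when $s=n$, an $n$-cell $C$ is $k$-mixed if $C_i$ is a segment for all $i\ne k$. One writes $S(\rho')\preceq S(\rho)$ or $S(\rho)\succeq S(\rho')$ (for two families on the same polytopes) if for every $C\in S(\rho)$ there is $D\in S(\rho')$ with $C\subset D$ and $C_i\subset D_i$ for all $i$. For nonempty finite sets $\mathcal{A}_i\subset M$ and $\boldsymbol{\nu}_i\in\mathbb{R}^{\mathcal{A}_i}$, $\vartheta_{\boldsymbol{\nu}_i}\colon\operatorname{conv}(\mathcal{A}_i)\to\mathbb{R}$ is given by $\vartheta_{\boldsymbol{\nu}_i}(x)=\min\{z\mid(x,z)\in\operatorname{conv}\{(a,\nu_{i,a})\}_{a\in\mathcal{A}_i}\}$, and $\Theta_{\boldsymbol{\nu}}=\boxplus_i\vartheta_{\boldsymbol{\nu}_i}$. (Finite unions of hyperplanes $W'_i$ and neighborhoods $U_i$ with the stated properties exist.) Incremental chains. An incremental chain of mixed subdivisions of $\Delta$ is a chain $S(\theta_0)\preceq\dots\preceq S(\theta_n)$ where, for each $k$, $\theta_k=\boxplus_{i=0}^n\theta_{k,i}$ for convex piecewise affine functions $\theta_{k,i}\colon\Delta_i\to\mathbb{R}$ with $\theta_{k,i}=0$ for all $i\ge k$. Admissibility. Let $\rho_i\colon\Delta_i\to\mathbb{R}$,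 $i=0,\dots,n$, be convex piecewise affine functions of the form $\rho_i=\vartheta_{\boldsymbol{\nu}_i}$ with $\boldsymbol{\nu}_i\in\mathbb{R}^{\mathcal{A}_i}$, whose inf-convolution $\rho$ induces a tight mixed subdivision $S(\rho)$ (here $\rho_i=\theta_{n,i}$ and $\rho=\theta_n$). Fix $\delta\in M_{\mathbb{R}}$ such that $(|S(\rho)^{n-1}|+\delta)\cap M=\emptyset$, where $|S(\rho)^{n-1}|$ is the union of the cells of $S(\rho)$ of dimension at most $n-1$. Each $b\in\mathcal{B}=(\Delta+\delta)\cap M$ lies in $C+\delta$ for a unique $n$-cell $C$ of $S(\rho)$; let $i(b)$ be the largest $i$ with $\dim(C_i)=0$, and set $\mathcal{B}_k=\{b\in\mathcal{B}\mid i(b)=k\}$. For an $n$-cell $D$ of a mixed subdivision coarser than $S(\rho)$, with components $D_i$, set $\boldsymbol{\mathcal{A}}_D=(\mathcal{A}_i\cap D_i)_{i=0}^n$, $\rho_D=\boxplus_i\rho_i|_{D_i}$ (so that $S(\rho_D)$ is a tight mixed subdivision of $D$) and $\mathcal{B}_{D,k}=\mathcal{B}_k\cap(D+\delta)$. An incremental chain $S(\theta_0)\preceq\dots\preceq S(\theta_n)$ with $S(\theta_n)\preceq S(\rho)$ is admissible for $S(\rho)$ if for $k=0,\dots,n$ every $n$-cell $D$ of $S(\theta_k)$ verifies at least one of: (1) the fundamental subfamily of $\boldsymbol{\mathcal{A}}_D$ has at most one support; (2) $\mathcal{B}_{D,k}$ is contained in the union of the translated $k$-mixed $n$-cells $C+\delta$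 of $S(\rho_D)$. Fundamental subfamily. For a family $\boldsymbol{\mathcal{A}}=(\mathcal{A}_0,\dots,\mathcal{A}_n)$, let $\mathbb{T}_M=\operatorname{Hom}(M,\mathbb{C}^\times)$ with characters $\chi^a$, let $\boldsymbol{u}_i=\{u_{i,a}\}_{a\in\mathcal{A}_i}$ be variables, $\boldsymbol{u}=(\boldsymbol{u}_0,\dots,\boldsymbol{u}_n)$, $F_i=\sum_{a\in\mathcal{A}_i}u_{i,a}\chi^a$, $\Omega_{\boldsymbol{\mathcal{A}}}\subset\mathbb{T}_M\times\prod_i\mathbb{P}(\mathbb{C}^{\mathcal{A}_i})$ the zero set of $F_0,\dots,F_n$ and $\varpi$ the projection onto the second factor. The sparse resultant $\operatorname{Res}_{\boldsymbol{\mathcal{A}}}$ is any primitive polynomial in $\mathbb{Z}[\boldsymbol{u}]$ giving an equation for the Weil divisor $\deg(\varpi|_{\Omega_{\boldsymbol{\mathcal{A}}}})\,\overline{\varpi(\Omega_{\boldsymbol{\mathcal{A}}})}$ if $\overline{\varpi(\Omega_{\boldsymbol{\mathcal{A}}})}$ is a hypersurface, and $\pm1$ otherwise. The fundamental subfamily of $\boldsymbol{\mathcal{A}}$ is $(\mathcal{A}_i)_{i\in J}$ for the minimal $J\subset\{0,\dots,n\}$ such that $\operatorname{Res}_{\boldsymbol{\mathcal{A}}}\in\mathbb{Z}[\{\boldsymbol{u}_i\}_{i\in J}]$. *)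

theory Defs
  imports
    "HOL-Analysis.Analysis"
    "HOL-Library.Poly_Mapping"
    "HOL-Library.Set_Algebras"
    "HOL-Computational_Algebra.Factorial_Ring"
begin

text \<open>
  A lattice of rank \<open>n\<close> is realised inside a Euclidean space \<open>'v\<close>, possibly of larger dimension, so
  that \<open>n = 0\<close> is included; \<open>M\<^sub>\<real>\<close> is \<open>span M\<close>. Every linear functional on \<open>span M\<close> has the form
  \<open>x \<mapsto> v \<bullet> x\<close>, and conversely every \<open>v :: 'v\<close> induces one, so a vector \<open>v :: 'v\<close> stands for the
  element of \<open>N\<^sub>\<real>\<close> that it induces (different vectors may induce the same element, which is harmless
  below). The dimension of a convex set is \<open>aff_dim\<close>.

  A family with members \<open>0, \<dots>, s\<close> is a function on \<open>nat\<close> of which only the values on \<open>{..s}\<close>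
  matter, and a function on a polytope is a total function of which only the values on the polytope
  matter. Sums of sets are Minkowski sums.
\<close>

definition lattice_of_rank :: "nat \<Rightarrow> 'v::euclidean_space set \<Rightarrow> bool" where
  "lattice_of_rank n M \<longleftrightarrow>
     (\<exists>E. independent E \<and> card E = n \<and> M = {\<Sum>e\<in>E. of_int (c e) *\<^sub>R e | c :: 'v \<Rightarrow> int. True})"

abbreviation translate :: "'v::euclidean_space set \<Rightarrow> 'v \<Rightarrow> 'v set" where
  "translate C \<delta> \<equiv> (\<lambda>x. x + \<delta>) ` C"


section \<open>Mixed subdivisions\<close>

definition convex_piecewise_affine :: "'v::euclidean_space set \<Rightarrow> ('v \<Rightarrow> real) \<Rightarrow> bool" where
  "convex_piecewise_affine P \<rho> \<longleftrightarrow> convex_on P \<rho> \<and>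
     (\<exists>\<P>. finite \<P> \<and> \<Union>\<P> = P \<and>
        (\<forall>Q\<in>\<P>. polytope Q \<and> (\<exists>w c. \<forall>x\<in>Q. \<rho> x = w \<bullet> x + c)))"

definition cell :: "'v::euclidean_space set \<Rightarrow> ('v \<Rightarrow> real) \<Rightarrow> 'v \<Rightarrow> 'v set" where
  "cell P \<rho> v = {x \<in> P. \<forall>y\<in>P. \<rho> x + v \<bullet> x \<le> \<rho> y + v \<bullet> y}"

definition subdivision :: "'v::euclidean_space set \<Rightarrow> ('v \<Rightarrow> real) \<Rightarrow> 'v set set" where
  "subdivision P \<rho> = range (cell P \<rho>)"

definition inf_conv ::
  "nat \<Rightarrow> (nat \<Rightarrow> 'v::euclidean_space set) \<Rightarrow> (nat \<Rightarrow> 'v \<Rightarrow> real) \<Rightarrow> 'v \<Rightarrow> real" where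
  "inf_conv s P \<rho> x =
     Inf {\<Sum>i\<le>s. \<rho> i (y i) | y. (\<forall>i\<le>s. y i \<in> P i) \<and> (\<Sum>i\<le>s. y i) = x}"

definition mixed_subdivision ::
  "nat \<Rightarrow> (nat \<Rightarrow> 'v::euclidean_space set) \<Rightarrow> (nat \<Rightarrow> 'v \<Rightarrow> real) \<Rightarrow> 'v set set" where
  "mixed_subdivision s P \<rho> = subdivision (\<Sum>i\<le>s. P i) (inf_conv s P \<rho>)"

definition component ::
  "nat \<Rightarrow> (nat \<Rightarrow> 'v::euclidean_space set) \<Rightarrow> (nat \<Rightarrow> 'v \<Rightarrow> real) \<Rightarrow> 'v set \<Rightarrow> nat \<Rightarrow> 'v set" where
  "component s P \<rho> C i =
     {y i | y. (\<forall>j\<le>s. y j \<in> P j) \<and> (\<Sum>j\<le>s. y j) \<in> C \<and>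
               inf_conv s P \<rho> (\<Sum>j\<le>s. y j) = (\<Sum>j\<le>s. \<rho> j (y j))}"

definition n_cells ::
  "nat \<Rightarrow> nat \<Rightarrow> (nat \<Rightarrow> 'v::euclidean_space set) \<Rightarrow> (nat \<Rightarrow> 'v \<Rightarrow> real) \<Rightarrow> 'v set set" where
  "n_cells n s P \<rho> = {C \<in> mixed_subdivision s P \<rho>. aff_dim C = int n}"

definition tight ::
  "nat \<Rightarrow> nat \<Rightarrow> (nat \<Rightarrow> 'v::euclidean_space set) \<Rightarrow> (nat \<Rightarrow> 'v \<Rightarrow> real) \<Rightarrow> bool" where
  "tight n s P \<rho> \<longleftrightarrow>
     (\<forall>C \<in> n_cells n s P \<rho>. (\<Sum>i\<le>s. aff_dim (component s P \<rho> C i)) = int n)"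

definition k_mixed ::
  "nat \<Rightarrow> (nat \<Rightarrow> 'v::euclidean_space set) \<Rightarrow> (nat \<Rightarrow> 'v \<Rightarrow> real) \<Rightarrow> nat \<Rightarrow> 'v set \<Rightarrow> bool" where
  "k_mixed n P \<rho> k C \<longleftrightarrow>
     (\<forall>i\<le>n. i \<noteq> k \<longrightarrow> (\<exists>a b. a \<noteq> b \<and> component n P \<rho> C i = closed_segment a b))"

text \<open>\<open>coarser s P \<rho>' \<rho>\<close> is the relation \<open>S(\<rho>') \<preceq> S(\<rho>)\<close>.\<close>

definition coarser ::
  "nat \<Rightarrow> (nat \<Rightarrow> 'v::euclidean_space set) \<Rightarrow> (nat \<Rightarrow> 'v \<Rightarrow> real) \<Rightarrow> (nat \<Rightarrow> 'v \<Rightarrow> real) \<Rightarrow> bool" where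
  "coarser s P \<rho>' \<rho> \<longleftrightarrow>
     (\<forall>C \<in> mixed_subdivision s P \<rho>. \<exists>D \<in> mixed_subdivision s P \<rho>'.
        C \<subseteq> D \<and> (\<forall>i\<le>s. component s P \<rho> C i \<subseteq> component s P \<rho>' D i))"

definition lower_hull :: "'v::euclidean_space set \<Rightarrow> ('v \<Rightarrow> real) \<Rightarrow> 'v \<Rightarrow> real" where
  "lower_hull A \<nu> x = (LEAST z. (x, z) \<in> convex hull ((\<lambda>a. (a, \<nu> a)) ` A))"


section \<open>The sparse resultant and the fundamental subfamily\<close>

text \<open>
  Polynomials in the variables \<open>u\<^bsub>i,a\<^esub>\<close> are finitely supported functions on exponent vectors, the
  variable \<open>u\<^bsub>i,a\<^esub>\<close> being indexed by the pair \<open>(i, a)\<close>.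
\<close>

type_synonym ('v, 'c) upoly = "((nat \<times> 'v) \<Rightarrow>\<^sub>0 nat) \<Rightarrow>\<^sub>0 'c"

definition indets :: "('v, 'c::zero) upoly \<Rightarrow> (nat \<times> 'v) set" where
  "indets p = (\<Union>m \<in> Poly_Mapping.keys p. Poly_Mapping.keys m)"

definition eval_upoly :: "(nat \<times> 'v \<Rightarrow> 'c) \<Rightarrow> ('v, 'c::comm_semiring_1) upoly \<Rightarrow> 'c" where
  "eval_upoly u p =
     (\<Sum>m \<in> Poly_Mapping.keys p. Poly_Mapping.lookup p m *
        (\<Prod>x \<in> Poly_Mapping.keys m. u x ^ Poly_Mapping.lookup m x))"

definition multihomogeneous :: "nat \<Rightarrow> (nat \<Rightarrow> 'v set) \<Rightarrow> ('v, 'c::zero) upoly \<Rightarrow> bool" where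
  "multihomogeneous n A p \<longleftrightarrow> indets p \<subseteq> Sigma {..n} A \<and>
     (\<exists>d. \<forall>m \<in> Poly_Mapping.keys p. \<forall>i\<le>n. (\<Sum>a\<in>A i. Poly_Mapping.lookup m (i, a)) = d i)"

text \<open>\<open>Hom(M, \<complex>\<^sup>\<times>)\<close>; the character \<open>\<chi>\<^sup>a\<close> takes the value \<open>t a\<close> at the point \<open>t\<close>.\<close>

definition torus :: "'v::euclidean_space set \<Rightarrow> ('v \<Rightarrow> complex) set" where
  "torus M = {t \<in> extensional M. (\<forall>a\<in>M. t a \<noteq> 0) \<and> (\<forall>a\<in>M. \<forall>b\<in>M. t (a + b) = t a * t b)}"

text \<open>
  Points of \<open>\<Prod>\<^sub>i \<P>(\<complex>\<^bsup>A\<^sub>i\<^esup>)\<close> are handled through homogeneous coordinates: \<open>proj_coords n A\<close> is the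
  set of all tuples of nonzero vectors, and a subset of the product of projective spaces is
  represented by the set of all coordinate tuples of its points. The sets \<open>incidence\<close>, \<open>zero_locus\<close>
  and \<open>zariski_closure\<close> below are stable under independent rescalings of the \<open>u\<^sub>i\<close>.
\<close>

definition proj_coords :: "nat \<Rightarrow> (nat \<Rightarrow> 'v set) \<Rightarrow> (nat \<times> 'v \<Rightarrow> complex) set" where
  "proj_coords n A =
     {u. (\<forall>x. x \<notin> Sigma {..n} A \<longrightarrow> u x = 0) \<and> (\<forall>i\<le>n. \<exists>a\<in>A i. u (i, a) \<noteq> 0)}"

definition incidence ::
  "'v::euclidean_space set \<Rightarrow> nat \<Rightarrow> (nat \<Rightarrow> 'v set) \<Rightarrow> (('v \<Rightarrow> complex) \<times> (nat \<times> 'v \<Rightarrow> complex)) set" where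
  "incidence M n A =
     {(t, u). t \<in> torus M \<and> u \<in> proj_coords n A \<and> (\<forall>i\<le>n. (\<Sum>a\<in>A i. u (i, a) * t a) = 0)}"

definition zero_locus ::
  "nat \<Rightarrow> (nat \<Rightarrow> 'v set) \<Rightarrow> ('v, complex) upoly set \<Rightarrow> (nat \<times> 'v \<Rightarrow> complex) set" where
  "zero_locus n A \<P> = {u \<in> proj_coords n A. \<forall>p\<in>\<P>. eval_upoly u p = 0}"

definition zariski_closure ::
  "nat \<Rightarrow> (nat \<Rightarrow> 'v set) \<Rightarrow> (nat \<times> 'v \<Rightarrow> complex) set \<Rightarrow> (nat \<times> 'v \<Rightarrow> complex) set" where
  "zariski_closure n A X =
     zero_locus n A {p. multihomogeneous n A p \<and> (\<forall>u\<in>X. eval_upoly u p = 0)}"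

text \<open>
  In a product of projective spaces, the closed subsets of pure codimension one are the nonempty
  zero loci of a single nonzero multihomogeneous polynomial.
\<close>

definition hypersurface :: "nat \<Rightarrow> (nat \<Rightarrow> 'v set) \<Rightarrow> (nat \<times> 'v \<Rightarrow> complex) set \<Rightarrow> bool" where
  "hypersurface n A V \<longleftrightarrow> V \<noteq> {} \<and> (\<exists>p. p \<noteq> 0 \<and> multihomogeneous n A p \<and> V = zero_locus n A {p})"

definition proj_image ::
  "'v::euclidean_space set \<Rightarrow> nat \<Rightarrow> (nat \<Rightarrow> 'v set) \<Rightarrow> (nat \<times> 'v \<Rightarrow> complex) set" where
  "proj_image M n A = zariski_closure n A (snd ` incidence M n A)"

text \<open>
  The degree of the projection from \<open>incidence\<close> onto its closed image, when this image is a
  hypersurface: both are then irreducible of the same dimension, and the degree is the number of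
  points of the fibres over a nonempty Zariski open subset of the image. Such an open subset may be
  taken to be the nonvanishing locus of one multihomogeneous polynomial. The fibre over the point
  with coordinates \<open>u\<close> is a set of points of the torus, hence is not affected by rescaling \<open>u\<close>.
\<close>

definition projection_degree :: "'v::euclidean_space set \<Rightarrow> nat \<Rightarrow> (nat \<Rightarrow> 'v set) \<Rightarrow> nat" where
  "projection_degree M n A =
     (THE d. \<exists>q. multihomogeneous n A q \<and> (\<exists>u \<in> proj_image M n A. eval_upoly u q \<noteq> 0) \<and>
        (\<forall>u \<in> proj_image M n A. eval_upoly u q \<noteq> 0 \<longrightarrow>
           finite {t. (t, u) \<in> incidence M n A} \<and> card {t. (t, u) \<in> incidence M n A} = d))"

text \<open>
  \<open>R\<close> is an equation for the Weil divisor \<open>d V\<close>, with \<open>V\<close> irreducible of codimension one, iff over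
  the complex numbers it is a nonzero constant times \<open>P\<^sup>d\<close>, where \<open>P\<close> is an irreducible polynomial
  with zero locus \<open>V\<close>.
\<close>

definition is_sparse_resultant ::
  "'v::euclidean_space set \<Rightarrow> nat \<Rightarrow> (nat \<Rightarrow> 'v set) \<Rightarrow> ('v, int) upoly \<Rightarrow> bool" where
  "is_sparse_resultant M n A R \<longleftrightarrow>
     (if hypersurface n A (proj_image M n A)
      then indets R \<subseteq> Sigma {..n} A \<and>
           Gcd (Poly_Mapping.lookup R ` Poly_Mapping.keys R) = 1 \<and>
           (\<exists>P c. irreducible P \<and> multihomogeneous n A P \<and>
              zero_locus n A {P} = proj_image M n A \<and> c \<noteq> 0 \<and>
              (Poly_Mapping.map of_int R :: ('v, complex) upoly) =
                Poly_Mapping.single 0 c * P ^ projection_degree M n A)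
      else R = 1 \<or> R = - 1)"

definition sparse_resultant ::
  "'v::euclidean_space set \<Rightarrow> nat \<Rightarrow> (nat \<Rightarrow> 'v set) \<Rightarrow> ('v, int) upoly" where
  "sparse_resultant M n A = (SOME R. is_sparse_resultant M n A R)"

text \<open>The index set of the fundamental subfamily; \<open>LEAST\<close> refers to inclusion of sets.\<close>

definition fundamental_indices :: "'v::euclidean_space set \<Rightarrow> nat \<Rightarrow> (nat \<Rightarrow> 'v set) \<Rightarrow> nat set" where
  "fundamental_indices M n A =
     (LEAST J. J \<subseteq> {..n} \<and> indets (sparse_resultant M n A) \<subseteq> Sigma J A)"


section \<open>Incremental chains and admissibility\<close>

text \<open>The family \<open>\<theta> k\<close> consists of the functions \<open>\<theta> k 0, \<dots>, \<theta> k n\<close>.\<close>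

definition incremental_chain ::
  "nat \<Rightarrow> (nat \<Rightarrow> 'v::euclidean_space set) \<Rightarrow> (nat \<Rightarrow> nat \<Rightarrow> 'v \<Rightarrow> real) \<Rightarrow> bool" where
  "incremental_chain n P \<theta> \<longleftrightarrow>
     (\<forall>k\<le>n. \<forall>i\<le>n. convex_piecewise_affine (P i) (\<theta> k i)) \<and>
     (\<forall>k\<le>n. \<forall>i\<le>n. k \<le> i \<longrightarrow> (\<forall>x\<in>P i. \<theta> k i x = 0)) \<and>
     (\<forall>k<n. coarser n P (\<theta> k) (\<theta> (Suc k)))"

definition generic_translation ::
  "'v::euclidean_space set \<Rightarrow> nat \<Rightarrow> (nat \<Rightarrow> 'v set) \<Rightarrow> (nat \<Rightarrow> 'v \<Rightarrow> real) \<Rightarrow> 'v \<Rightarrow> bool" where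
  "generic_translation M n P \<rho> \<delta> \<longleftrightarrow> \<delta> \<in> span M \<and>
     translate (\<Union>{C \<in> mixed_subdivision n P \<rho>. aff_dim C \<le> int n - 1}) \<delta> \<inter> M = {}"

definition cell_index ::
  "nat \<Rightarrow> (nat \<Rightarrow> 'v::euclidean_space set) \<Rightarrow> (nat \<Rightarrow> 'v \<Rightarrow> real) \<Rightarrow> 'v \<Rightarrow> 'v \<Rightarrow> nat" where
  "cell_index n P \<rho> \<delta> b =
     (let C = (THE C. C \<in> n_cells n n P \<rho> \<and> b \<in> translate C \<delta>)
      in Max {i. i \<le> n \<and> aff_dim (component n P \<rho> C i) = 0})"

definition lattice_points_of_index ::
  "'v::euclidean_space set \<Rightarrow> nat \<Rightarrow> (nat \<Rightarrow> 'v set) \<Rightarrow> (nat \<Rightarrow> 'v \<Rightarrow> real) \<Rightarrow> 'v \<Rightarrow> nat \<Rightarrow> 'v set" where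
  "lattice_points_of_index M n P \<rho> \<delta> k =
     {b \<in> translate (\<Sum>i\<le>n. P i) \<delta> \<inter> M. cell_index n P \<rho> \<delta> b = k}"

text \<open>
  The first two conjuncts are the requirements on \<open>\<rho>\<close> under which the notion is introduced; the
  genericity of \<open>\<delta>\<close> is kept apart in \<open>generic_translation\<close>.
\<close>

definition admissible ::
  "'v::euclidean_space set \<Rightarrow> nat \<Rightarrow> (nat \<Rightarrow> 'v set) \<Rightarrow> (nat \<Rightarrow> 'v \<Rightarrow> real) \<Rightarrow> 'v \<Rightarrow>
     (nat \<Rightarrow> nat \<Rightarrow> 'v \<Rightarrow> real) \<Rightarrow> bool" where
  "admissible M n A \<rho> \<delta> \<theta> \<longleftrightarrow>
     (let P = (\<lambda>i. convex hull (A i)) in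
        (\<exists>\<nu>. \<forall>i\<le>n. \<forall>x\<in>P i. \<rho> i x = lower_hull (A i) (\<nu> i) x) \<and>
        tight n n P \<rho> \<and>
        incremental_chain n P \<theta> \<and>
        coarser n P (\<theta> n) \<rho> \<and>
        (\<forall>k\<le>n. \<forall>D \<in> n_cells n n P (\<theta> k).
           let D' = component n P (\<theta> k) D in
             card (fundamental_indices M n (\<lambda>i. A i \<inter> D' i)) \<le> 1 \<or>
             lattice_points_of_index M n P \<rho> \<delta> k \<inter> translate D \<delta> \<subseteq>
               \<Union>{translate C \<delta> | C. C \<in> n_cells n n D' \<rho> \<and> k_mixed n D' \<rho> k C}))"


section \<open>Spaces of lifting vectors\<close>

text \<open>
  A point of \<open>\<real>\<^bsup>A\<^sub>0\<^esup> \<times> \<dots> \<times> \<real>\<^bsup>A\<^sub>s\<^esup>\<close> is a function \<open>\<nu>\<close>, of which only the values \<open>\<nu> j a\<close> with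
  \<open>j \<le> s\<close> and \<open>a \<in> A j\<close> matter. Hyperplanes may be affine.
\<close>

definition lifting_hyperplane ::
  "nat \<Rightarrow> (nat \<Rightarrow> 'v set) \<Rightarrow> (nat \<Rightarrow> 'v \<Rightarrow> real) set \<Rightarrow> bool" where
  "lifting_hyperplane s A H \<longleftrightarrow>
     (\<exists>c d. (\<exists>j\<le>s. \<exists>a\<in>A j. c j a \<noteq> 0) \<and> H = {\<nu>. (\<Sum>j\<le>s. \<Sum>a\<in>A j. c j a * \<nu> j a) = d})"

definition finite_union_of_hyperplanes ::
  "nat \<Rightarrow> (nat \<Rightarrow> 'v set) \<Rightarrow> (nat \<Rightarrow> 'v \<Rightarrow> real) set \<Rightarrow> bool" where
  "finite_union_of_hyperplanes s A W \<longleftrightarrow>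
     (\<exists>\<H>. finite \<H> \<and> (\<forall>H\<in>\<H>. lifting_hyperplane s A H) \<and> W = \<Union>\<H>)"

definition lifting_neighborhood ::
  "nat \<Rightarrow> (nat \<Rightarrow> 'v set) \<Rightarrow> (nat \<Rightarrow> 'v \<Rightarrow> real) \<Rightarrow> (nat \<Rightarrow> 'v \<Rightarrow> real) set \<Rightarrow> bool" where
  "lifting_neighborhood s A p U \<longleftrightarrow>
     (\<exists>\<epsilon>>0. \<forall>\<nu>. (\<forall>j\<le>s. \<forall>a\<in>A j. \<bar>\<nu> j a - p j a\<bar> < \<epsilon>) \<longrightarrow> \<nu> \<in> U)"

text \<open>\<open>(\<nu>\<^sub>0, \<dots>, \<nu>\<^bsub>k-1\<^esub>, 0, 0, \<dots>)\<close>\<close>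

definition zero_from :: "nat \<Rightarrow> (nat \<Rightarrow> 'v \<Rightarrow> real) \<Rightarrow> nat \<Rightarrow> 'v \<Rightarrow> real" where
  "zero_from k \<nu> j a = (if j < k then \<nu> j a else 0)"

end

theory Submission
  imports Defs
begin

text \<open>
  Fix an \<open>n\<close>-cell \<open>D\<close> of \<open>S(\<theta>\<^sub>k)\<close> with components \<open>D\<^sub>i\<close>, and suppose that \<open>D\<close> violates the second
  alternative of admissibility. Then some \<open>n\<close>-cell \<open>C \<subseteq> D\<close> of \<open>S(\<theta>\<^sub>n)\<close> has \<open>dim C\<^sub>k = 0\<close> and
  \<open>dim C\<^sub>i > 0\<close> for \<open>i > k\<close> without being \<open>k\<close>-mixed. The \<open>n + 1\<close> dimensions \<open>dim C\<^sub>i\<close> add up to \<open>n\<close>, so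
  if all those with \<open>i \<noteq> k\<close> were positive they would be equal to one; hence \<open>dim C\<^sub>i = 0\<close> for some
  \<open>i < k\<close>. The choice of \<open>(\<nu>\<^sub>0, \<dots>, \<nu>\<^bsub>k-1\<^esub>)\<close> outside \<open>W\<^bsub>k-1\<^esub>\<close> says that \<open>D\<close>, viewed as the sum of
  \<open>D\<^sub>0, \<dots>, D\<^bsub>k-1\<^esub>\<close> and \<open>\<Sum>\<^bsub>i\<ge>k\<^esub> D\<^sub>i\<close>, has summands whose dimensions add up to \<open>n\<close>
  (\<open>tight_regroup\<close>). As \<open>C\<close> is \<open>n\<close>-dimensional and its summands lie in those of \<open>D\<close>, there is no room
  left: \<open>dim C\<^sub>i = dim D\<^sub>i\<close> for \<open>i < k\<close>. So some \<open>D\<^sub>i\<close> is a point, one polynomial of the family \<open>A\<^sub>D\<close>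
  is a monomial, which has no zero in the torus, the resultant is \<open>\<plusminus>1\<close>, and the fundamental
  subfamily is empty (\<open>fundamental_indices_eq_empty\<close>): the first alternative holds.

  Two facts make this precise. First, the cell of an inf-convolution selected by a functional \<open>v\<close> is
  the Minkowski sum of the cells of the summands selected by \<open>v\<close>, and these are its components
  (\<open>cell_inf_conv\<close>). Second, a lattice point \<open>b\<close> determines \<open>C\<close>, and every cell of a coarser
  subdivision that contains \<open>b - \<delta>\<close> contains all of \<open>C\<close>
  (\<open>generic_point_in_unique_coarse_cell\<close>), because \<open>b - \<delta>\<close> avoids the lower dimensional cells.

  All of this is polyhedral. It is derived from one property of the functions involved, that their
  graph is the lower boundary of a polytope; lower hulls have it and inf-convolutions inherit it.
  That \<open>S(\<theta>\<^sub>k) \<preceq> S(\<theta>\<^bsub>k+1\<^esub>)\<close> is the choice of \<open>\<nu>\<^sub>k\<close> inside the neighborhood \<open>U\<^sub>k\<close>, since the lower hull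
  of the zero lifting is the zero function.
\<close>


section \<open>Polyhedral functions and their cells\<close>

text \<open>
  The property shared by lower hulls of liftings and their inf-convolutions: the graph of \<open>\<rho>\<close> over \<open>P\<close>
  is the lower boundary of a polytope \<open>Q\<close> one dimension higher. Cells of \<open>\<rho>\<close> are then shadows of
  faces of \<open>Q\<close>, so finiteness statements about polytopes carry over to the subdivision.
\<close>

definition polytopal_function :: "'v::euclidean_space set \<Rightarrow> ('v \<Rightarrow> real) \<Rightarrow> bool" where
  "polytopal_function P \<rho> \<longleftrightarrow>
     (\<exists>Q. polytope Q \<and> Q \<noteq> {} \<and> fst ` Q = P \<and>
        (\<forall>x\<in>P. (x, \<rho> x) \<in> Q \<and> (\<forall>t. (x, t) \<in> Q \<longrightarrow> \<rho> x \<le> t)))"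

lemma polytopal_functionE:
  assumes "polytopal_function P \<rho>"
  obtains Q where "polytope Q" "Q \<noteq> {}" "fst ` Q = P"
    "\<And>x. x \<in> P \<Longrightarrow> (x, \<rho> x) \<in> Q" "\<And>x t. (x, t) \<in> Q \<Longrightarrow> x \<in> P \<and> \<rho> x \<le> t"
proof -
  from assms obtain Q where "polytope Q" "Q \<noteq> {}" "fst ` Q = P"
    "\<forall>x\<in>P. (x, \<rho> x) \<in> Q \<and> (\<forall>t. (x, t) \<in> Q \<longrightarrow> \<rho> x \<le> t)"
    unfolding polytopal_function_def by blast
  then show thesis
    using that[of Q] by (metis fst_conv image_eqI)
qed

lemma polytopal_function_cong:
  assumes "polytopal_function P \<rho>" and "\<And>x. x \<in> P \<Longrightarrow> \<rho> x = \<rho>' x"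
  shows "polytopal_function P \<rho>'"
  using assms unfolding polytopal_function_def by auto

lemma fst_image_polytope: "polytope Q \<Longrightarrow> polytope (fst ` Q)"
  by (rule polytope_linear_image[OF linear_fst])

lemma polytopal_function_imp_polytope: "polytopal_function P \<rho> \<Longrightarrow> polytope P"
  by (metis polytopal_functionE fst_image_polytope)

text \<open>
  Cutting \<open>Q\<close> down to the cylinder over \<open>R\<close> keeps it a polytope once the height of the cylinder is
  bounded by the vertical extent of \<open>Q\<close>.
\<close>

lemma polytopal_function_restrict:
  assumes "polytopal_function P \<rho>" and "polytope R" "R \<subseteq> P" "R \<noteq> {}"
  shows "polytopal_function R \<rho>"
proof -
  obtain Q where Q: "polytope Q" "Q \<noteq> {}" "fst ` Q = P"
    "\<And>x. x \<in> P \<Longrightarrow> (x, \<rho> x) \<in> Q" "\<And>x t. (x, t) \<in> Q \<Longrightarrow> x \<in> P \<and> \<rho> x \<le> t"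
    using polytopal_functionE[OF assms(1)] by metis
  let ?Q = "Q \<inter> (R \<times> snd ` Q)"
  have mem: "(x, \<rho> x) \<in> ?Q" if "x \<in> R" for x
    using that assms(3) Q(4)[of x] by force
  have "polytope (snd ` Q)"
    by (rule polytope_linear_image[OF linear_snd Q(1)])
  then have "polytope ?Q"
    by (intro polytope_Int polytope_Times Q(1) assms(2))
  moreover have "fst ` ?Q = R"
    using mem by force
  moreover have "?Q \<noteq> {}"
    using mem assms(4) by blast
  ultimately show ?thesis
    unfolding polytopal_function_def using mem Q(5)
    by (intro exI[of _ ?Q]) blast
qed

text \<open>
  Compactness is what turns the formal \<open>LEAST\<close> and \<open>Inf\<close> in the definitions of lower hulls and
  inf-convolutions into attained minima.
\<close>

lemma compact_fibre_has_least:
  fixes Q :: "('v::euclidean_space \<times> real) set"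
  assumes "compact Q" and "(x, t) \<in> Q"
  obtains z where "(x, z) \<in> Q" "\<And>t. (x, t) \<in> Q \<Longrightarrow> z \<le> t"
proof -
  have "closed ({x} \<times> (UNIV :: real set))"
    by (intro closed_Times) auto
  then have "compact (Q \<inter> ({x} \<times> UNIV))"
    using assms(1) by (rule compact_Int_closed[rotated])
  then obtain q where q: "q \<in> Q \<inter> ({x} \<times> UNIV)" "\<forall>q'\<in>Q \<inter> ({x} \<times> UNIV). snd q \<le> snd q'"
    using continuous_attains_inf[of "Q \<inter> ({x} \<times> UNIV)" snd] assms(2) continuous_on_snd[OF continuous_on_id]
    by blast
  have "(x, snd q) \<in> Q"
    using q(1) by auto
  moreover have "snd q \<le> t" if "(x, t) \<in> Q" for t
    using bspec[OF q(2), of "(x, t)"] that by simp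
  ultimately show thesis
    by (rule that)
qed

lemma lower_hull_least:
  assumes "finite A" and "x \<in> convex hull A"
  shows "(x, lower_hull A \<nu> x) \<in> convex hull ((\<lambda>a. (a, \<nu> a)) ` A)"
    and "\<And>t. (x, t) \<in> convex hull ((\<lambda>a. (a, \<nu> a)) ` A) \<Longrightarrow> lower_hull A \<nu> x \<le> t"
proof -
  let ?Q = "convex hull ((\<lambda>a. (a, \<nu> a)) ` A)"
  have "fst ` ?Q = convex hull A"
    by (simp add: convex_hull_linear_image linear_fst image_image)
  then obtain t where "(x, t) \<in> ?Q"
    using assms(2) by (metis (no_types, lifting) image_iff prod.collapse)
  moreover have "compact ?Q"
    using assms(1) by (simp add: finite_imp_compact_convex_hull)
  ultimately obtain z where z: "(x, z) \<in> ?Q" "\<And>t. (x, t) \<in> ?Q \<Longrightarrow> z \<le> t"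
    using compact_fibre_has_least by blast
  then have "lower_hull A \<nu> x = z"
    unfolding lower_hull_def by (intro Least_equality)
  with z show "(x, lower_hull A \<nu> x) \<in> ?Q" "(x, t) \<in> ?Q \<Longrightarrow> lower_hull A \<nu> x \<le> t" for t
    by auto
qed

lemma polytopal_function_lower_hull:
  assumes "finite A" "A \<noteq> {}"
  shows "polytopal_function (convex hull A) (lower_hull A \<nu>)"
  unfolding polytopal_function_def
proof (intro exI conjI ballI allI impI)
  let ?Q = "convex hull ((\<lambda>a. (a, \<nu> a)) ` A)"
  show "polytope ?Q" "?Q \<noteq> {}"
    using assms by (auto simp: polytope_convex_hull)
  show "fst ` ?Q = convex hull A"
    by (simp add: convex_hull_linear_image linear_fst image_image)
qed (use lower_hull_least[OF assms(1)] in blast)+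

lemma lower_hull_zero:
  assumes "finite A" "x \<in> convex hull A"
  shows "lower_hull A (\<lambda>_. 0) x = 0"
proof -
  have "linear (\<lambda>x::'a. (x, 0::real))"
    by (intro linearI) auto
  then have "convex hull ((\<lambda>a. (a, 0)) ` A) = (\<lambda>x. (x, 0::real)) ` (convex hull A)"
    by (simp add: convex_hull_linear_image)
  with lower_hull_least(1)[OF assms, of "\<lambda>_. 0"] show ?thesis
    by auto
qed

lemma polytopal_function_zero:
  assumes "polytope P" "P \<noteq> {}"
  shows "polytopal_function P (\<lambda>_. 0)"
  unfolding polytopal_function_def
proof (intro exI conjI)
  show "polytope (P \<times> {0::real})"
    using assms by (intro polytope_Times) (auto simp: polytope_sing)
qed (use assms in auto)

text \<open>
  The functional \<open>(v, 1)\<close> attains its minimum over \<open>Q\<close> on a face of \<open>Q\<close>. The points of that face lie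
  on the lower boundary, so projecting it gives exactly the cell of \<open>v\<close>.
\<close>

lemma cell_polytopal_function:
  assumes "polytopal_function P \<rho>"
  shows cell_nonempty: "cell P \<rho> v \<noteq> {}"
    and polytope_cell: "polytope (cell P \<rho> v)"
    and finite_subdivision: "finite (subdivision P \<rho>)"
proof -
  obtain Q where Q: "polytope Q" "Q \<noteq> {}" "fst ` Q = P"
    "\<And>x. x \<in> P \<Longrightarrow> (x, \<rho> x) \<in> Q" "\<And>x t. (x, t) \<in> Q \<Longrightarrow> x \<in> P \<and> \<rho> x \<le> t"
    using polytopal_functionE[OF assms(1)] by metis
  have face: "\<exists>F. F face_of Q \<and> F \<noteq> {} \<and> cell P \<rho> v = fst ` F" for v
  proof -
    obtain q where q: "q \<in> Q" "\<forall>q'\<in>Q. (v, 1) \<bullet> q \<le> (v, 1) \<bullet> q'"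
      using continuous_attains_inf[OF polytope_imp_compact[OF Q(1)] Q(2), of "\<lambda>q. (v, 1) \<bullet> q"]
        continuous_on_inner[OF continuous_on_const continuous_on_id]
      by blast
    define m where "m = (v, 1) \<bullet> q"
    let ?F = "Q \<inter> {p. (v, 1) \<bullet> p = m}"
    have m: "m \<le> \<rho> y + v \<bullet> y" if "y \<in> P" for y
      using q(2) Q(4)[OF that] by (fastforce simp: m_def inner_Pair)
    have "q = (fst q, snd q)"
      by simp
    then have q': "fst q \<in> P" "\<rho> (fst q) + v \<bullet> fst q \<le> m"
      using Q(5)[of "fst q" "snd q"] q(1) by (auto simp: m_def inner_prod_def)
    have "cell P \<rho> v = fst ` ?F"
    proof (intro subset_antisym subsetI)
      fix x assume x: "x \<in> cell P \<rho> v"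
      then have "\<rho> x + v \<bullet> x = m"
        using q' m[of x] by (force simp: cell_def)
      then have "(x, \<rho> x) \<in> ?F"
        using x Q(4)[of x] by (simp add: cell_def inner_Pair)
      then show "x \<in> fst ` ?F"
        by force
    next
      fix x assume "x \<in> fst ` ?F"
      then obtain t where t: "(x, t) \<in> Q" "v \<bullet> x + t = m"
        by (auto simp: inner_Pair)
      then show "x \<in> cell P \<rho> v"
        using Q(5)[OF t(1)] m by (fastforce simp: cell_def)
    qed
    moreover have "?F face_of Q"
      using q polytope_imp_convex[OF Q(1)]
      by (intro face_of_Int_supporting_hyperplane_ge) (auto simp: m_def)
    moreover have "?F \<noteq> {}"
      using q(1) by (auto simp: m_def)
    ultimately show ?thesis
      by blast
  qed
  show "cell P \<rho> v \<noteq> {}"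
    using face[of v] by auto
  show "polytope (cell P \<rho> v)"
    using face[of v] face_of_polytope_polytope[OF Q(1)] fst_image_polytope by metis
  have "subdivision P \<rho> \<subseteq> (`) fst ` {F. F face_of Q}"
  proof
    fix C assume "C \<in> subdivision P \<rho>"
    then obtain v where "C = cell P \<rho> v"
      by (auto simp: subdivision_def)
    with face[of v] show "C \<in> (`) fst ` {F. F face_of Q}"
      by blast
  qed
  then show "finite (subdivision P \<rho>)"
    using finite_polytope_faces[OF Q(1)] by (meson finite_imageI finite_subset)
qed

text \<open>
  A polytope is a finite intersection of half-spaces. The points lying slightly below \<open>(x, \<rho> x)\<close> are
  outside \<open>Q\<close>, so by the pigeonhole principle one half-space is violated by points arbitrarily
  close to \<open>(x, \<rho> x)\<close>. Its boundary hyperplane then passes through \<open>(x, \<rho> x)\<close> and is not vertical,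
  and its slope is the negative of the functional sought. The argument works at boundary points of \<open>P\<close> as
  well, where a supporting hyperplane taken without this care may be vertical.
\<close>

lemma in_some_cell:
  assumes "polytopal_function P \<rho>" and x: "x \<in> P"
  obtains v where "x \<in> cell P \<rho> v"
proof -
  obtain Q where Q: "polytope Q" "Q \<noteq> {}" "fst ` Q = P"
    "\<And>x. x \<in> P \<Longrightarrow> (x, \<rho> x) \<in> Q" "\<And>x t. (x, t) \<in> Q \<Longrightarrow> x \<in> P \<and> \<rho> x \<le> t"
    using polytopal_functionE[OF assms(1)] by metis
  obtain F where F: "finite F" "Q = \<Inter>F"
      "\<forall>h\<in>F. \<exists>a b. a \<noteq> 0 \<and> h = {x. a \<bullet> x \<le> b}"
    using polytope_imp_polyhedron[OF Q(1)] unfolding polyhedron_def by blast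
  let ?p = "\<lambda>m::nat. (x, \<rho> x - inverse (real (Suc m)))"
  (* The half-space cutting off the point may depend on its depth; some half-space recurs infinitely often. *)
  have "\<forall>m\<in>(UNIV :: nat set). \<exists>h\<in>F. ?p m \<notin> h"
  proof
    fix m :: nat
    have "?p m \<notin> Q"
      using Q(5)[of x "\<rho> x - inverse (real (Suc m))"] by auto
    then show "\<exists>h\<in>F. ?p m \<notin> h"
      using F(2) by blast
  qed
  from pigeonhole_infinite_rel[OF infinite_UNIV_nat F(1) this]
  obtain h where h: "h \<in> F" "infinite {m \<in> (UNIV :: nat set). ?p m \<notin> h}" ..
  obtain a b where ab: "h = {x. a \<bullet> x \<le> b}"
    using F(3) h(1) by blast
  obtain u c where a: "a = (u, c)"
    by (cases a)
  have le: "u \<bullet> y + c * t \<le> b" if "(y, t) \<in> Q" for y t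
    using that h(1) ab F(2) by (auto simp: a inner_Pair)
  have far: "\<exists>m>N. b < u \<bullet> x + c * (\<rho> x - inverse (real (Suc m)))" for N
  proof -
    obtain m where "m > N" "?p m \<notin> h"
      using h(2) unfolding infinite_nat_iff_unbounded by blast
    then show ?thesis
      unfolding ab a by (intro exI[of _ m]) (simp add: inner_Pair not_le)
  qed
  have x_le: "u \<bullet> x + c * \<rho> x \<le> b"
    using le Q(4)[OF x] by blast
  have "c < 0"
  proof (rule ccontr)
    assume "\<not> c < 0"
    then have "c * (\<rho> x - inverse (real (Suc m))) \<le> c * \<rho> x" for m
      by (intro mult_left_mono) auto
    then show False
      using far[of 0] x_le by (smt (verit))
  qed
  have "b \<le> u \<bullet> x + c * \<rho> x"
  proof (rule ccontr)
    assume "\<not> ?thesis"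
    then have "0 < (b - (u \<bullet> x + c * \<rho> x)) / (- c)"
      using \<open>c < 0\<close> by (intro divide_pos_pos) auto
    then obtain N where N: "inverse (real (Suc N)) < (b - (u \<bullet> x + c * \<rho> x)) / (- c)"
      using reals_Archimedean by blast
    obtain m where m: "m > N" "b < u \<bullet> x + c * (\<rho> x - inverse (real (Suc m)))"
      using far by blast
    have "inverse (real (Suc m)) \<le> inverse (real (Suc N))"
      using m(1) by (simp add: field_simps)
    then have "inverse (real (Suc m)) * (- c) < b - (u \<bullet> x + c * \<rho> x)"
      using N \<open>c < 0\<close> by (subst (asm) less_divide_eq) (smt (verit) mult_right_mono)
    then show False
      using m(2) by (simp add: algebra_simps)
  qed
  then have min: "u \<bullet> y + c * \<rho> y \<le> u \<bullet> x + c * \<rho> x" if "y \<in> P" for y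
    using le[OF Q(4)[OF that]] by linarith
  have "x \<in> cell P \<rho> (u /\<^sub>R c)"
    unfolding cell_def
  proof (intro CollectI conjI ballI x)
    fix y assume "y \<in> P"
    from min[OF this] \<open>c < 0\<close> have "(u \<bullet> x + c * \<rho> x) / c \<le> (u \<bullet> y + c * \<rho> y) / c"
      by (simp add: divide_right_mono_neg)
    moreover have "(u \<bullet> z + c * \<rho> z) / c = \<rho> z + (u /\<^sub>R c) \<bullet> z" for z
      using \<open>c < 0\<close> by (simp add: field_simps)
    ultimately show "\<rho> x + (u /\<^sub>R c) \<bullet> x \<le> \<rho> y + (u /\<^sub>R c) \<bullet> y"
      by simp
  qed
  then show thesis
    by (rule that)
qed

text \<open>
  There are finitely many cells, so along \<open>\<epsilon> = 1/m\<close> some cell recurs infinitely often; its points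
  minimise \<open>\<rho> + v + \<epsilon> u\<close> for arbitrarily small \<open>\<epsilon>\<close>, hence also \<open>\<rho> + v\<close> in the limit.
\<close>

lemma small_perturbation_refines_cell:
  assumes "polytopal_function P \<rho>"
  obtains \<epsilon> :: real where "\<epsilon> > 0" "cell P \<rho> (v + \<epsilon> *\<^sub>R u) \<subseteq> cell P \<rho> v"
proof -
  define e where "e m = inverse (real (Suc m))" for m
  define C where "C m = cell P \<rho> (v + e m *\<^sub>R u)" for m
  have "range C \<subseteq> subdivision P \<rho>"
    by (auto simp: C_def subdivision_def)
  then have "finite (range C)"
    using finite_subdivision[OF assms] finite_subset by blast
  then obtain m0 where m0: "infinite {m \<in> UNIV. C m = C m0}"
    using pigeonhole_infinite[OF infinite_UNIV_nat, of C] by blast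
  have "C m0 \<subseteq> cell P \<rho> v"
  proof
    fix x assume x: "x \<in> C m0"
    then have "x \<in> P"
      by (simp add: C_def cell_def)
    moreover have "\<rho> x + v \<bullet> x \<le> \<rho> y + v \<bullet> y" if y: "y \<in> P" for y
    proof (rule ccontr)
      assume "\<not> ?thesis"
      then have d: "0 < \<rho> x + v \<bullet> x - (\<rho> y + v \<bullet> y)" (is "0 < ?d")
        by simp
      define K where "K = \<bar>u \<bullet> y - u \<bullet> x\<bar> + 1"
      have "0 < ?d / K"
        using d by (simp add: K_def add_nonneg_pos)
      then obtain N where N: "inverse (real (Suc N)) < ?d / K"
        using reals_Archimedean by blast
      obtain m where m: "m > N" "C m = C m0"
        using m0 unfolding infinite_nat_iff_unbounded by blast
      have "e m \<le> inverse (real (Suc N))"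
        using m(1) by (simp add: e_def field_simps)
      then have "e m < ?d / K"
        using N by simp
      then have "e m * K < ?d"
        by (subst (asm) less_divide_eq) (auto simp: K_def split: if_splits)
      moreover have "e m > 0"
        by (simp add: e_def)
      then have "e m * (u \<bullet> y - u \<bullet> x) \<le> e m * K"
        by (intro mult_left_mono) (auto simp: K_def)
      moreover have "\<rho> x + (v + e m *\<^sub>R u) \<bullet> x \<le> \<rho> y + (v + e m *\<^sub>R u) \<bullet> y"
        using x y unfolding m(2)[symmetric] by (simp add: C_def cell_def)
      ultimately show False
        by (simp add: inner_add_left algebra_simps)
    qed
    ultimately show "x \<in> cell P \<rho> v"
      by (simp add: cell_def)
  qed
  then show thesis
    by (intro that[of "e m0"]) (auto simp: C_def e_def)
qed

lemma polytopal_function_imp_convex_on: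
  assumes "polytopal_function P \<rho>"
  shows "convex_on P \<rho>"
  unfolding convex_on_def
proof (intro conjI ballI allI impI)
  obtain Q where Q: "polytope Q" "Q \<noteq> {}" "fst ` Q = P"
    "\<And>x. x \<in> P \<Longrightarrow> (x, \<rho> x) \<in> Q" "\<And>x t. (x, t) \<in> Q \<Longrightarrow> x \<in> P \<and> \<rho> x \<le> t"
    using polytopal_functionE[OF assms(1)] by metis
  show "convex P"
    using polytopal_function_imp_polytope[OF assms] polytope_imp_convex by blast
  fix x y and a b :: real assume "x \<in> P" "y \<in> P" "0 \<le> a" "0 \<le> b" "a + b = 1"
  then have "a *\<^sub>R (x, \<rho> x) + b *\<^sub>R (y, \<rho> y) \<in> Q"
    using Q(4) polytope_imp_convex[OF Q(1)] by (intro convexD) auto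
  then show "\<rho> (a *\<^sub>R x + b *\<^sub>R y) \<le> a * \<rho> x + b * \<rho> y"
    using Q(5) by auto
qed

lemma polytopal_function_imp_convex_piecewise_affine:
  assumes "polytopal_function P \<rho>"
  shows "convex_piecewise_affine P \<rho>"
  unfolding convex_piecewise_affine_def
proof (intro conjI exI[of _ "subdivision P \<rho>"] ballI)
  show "convex_on P \<rho>"
    by (rule polytopal_function_imp_convex_on[OF assms])
  show "finite (subdivision P \<rho>)"
    by (rule finite_subdivision[OF assms])
  show "\<Union>(subdivision P \<rho>) = P"
  proof (intro subset_antisym subsetI)
    fix x assume "x \<in> P"
    then show "x \<in> \<Union>(subdivision P \<rho>)"
      using in_some_cell[OF assms] by (metis UnionI rangeI subdivision_def)
  qed (auto simp: subdivision_def cell_def)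
  fix Q assume "Q \<in> subdivision P \<rho>"
  then obtain v where v: "Q = cell P \<rho> v"
    by (auto simp: subdivision_def)
  then show "polytope Q"
    by (simp add: polytope_cell[OF assms])
  obtain y where y: "y \<in> Q"
    using cell_nonempty[OF assms] v by blast
  have "\<forall>x\<in>Q. \<rho> x = (- v) \<bullet> x + (\<rho> y + v \<bullet> y)"
    using y v by (fastforce simp: cell_def)
  then show "\<exists>w c. \<forall>x\<in>Q. \<rho> x = w \<bullet> x + c"
    by blast
qed

lemma cell_restrict:
  assumes "cell P \<rho> v \<subseteq> R" "R \<subseteq> P" "cell P \<rho> v \<noteq> {}"
  shows "cell R \<rho> v = cell P \<rho> v"
proof -
  obtain y where y: "y \<in> cell P \<rho> v"
    using assms(3) by blast
  have "x \<in> cell P \<rho> v" if x: "x \<in> cell R \<rho> v" for x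
  proof -
    have "\<rho> x + v \<bullet> x \<le> \<rho> y + v \<bullet> y"
      using x y assms(1) by (auto simp: cell_def)
    also have "\<rho> y + v \<bullet> y \<le> \<rho> z + v \<bullet> z" if "z \<in> P" for z
      using y that by (simp add: cell_def)
    finally show ?thesis
      using x assms(2) by (auto simp: cell_def)
  qed
  moreover have "x \<in> cell R \<rho> v" if "x \<in> cell P \<rho> v" for x
    using that assms(1,2) by (auto simp: cell_def)
  ultimately show ?thesis
    by blast
qed


section \<open>Minkowski sums and affine dimension\<close>

lemma mem_set_sum_iff:
  fixes S :: "'i \<Rightarrow> 'v::comm_monoid_add set"
  assumes "finite I"
  shows "x \<in> sum S I \<longleftrightarrow> (\<exists>y. (\<forall>i\<in>I. y i \<in> S i) \<and> sum y I = x)"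
  unfolding set_sum_alt[OF assms] by auto

lemma set_sum_subset:
  fixes S :: "'i \<Rightarrow> 'v::comm_monoid_add set"
  assumes "finite I" "\<And>i. i \<in> I \<Longrightarrow> S i \<subseteq> T i"
  shows "sum S I \<subseteq> sum T I"
  using assms by (fastforce simp: mem_set_sum_iff)

lemma polytope_set_sum:
  fixes S :: "'i \<Rightarrow> 'v::euclidean_space set"
  assumes "finite I" "\<And>i. i \<in> I \<Longrightarrow> polytope (S i)"
  shows "polytope (sum S I)"
  using assms
proof (induction rule: finite_induct)
  case empty
  then show ?case
    by (simp add: set_zero polytope_sing)
next
  case (insert i I)
  have "linear (\<lambda>(x::'v, y). x + y)"
    by (auto simp: linear_iff algebra_simps)
  then show ?case
    using insert by (simp add: set_plus_image polytope_linear_image polytope_Times)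
qed

lemma finite_set_sum:
  fixes S :: "'i \<Rightarrow> 'v::comm_monoid_add set"
  assumes "\<And>i. i \<in> I \<Longrightarrow> finite (S i)"
  shows "finite (sum S I)"
  using assms by (induction I rule: infinite_finite_induct) (auto simp: set_zero finite_set_plus)

lemma set_sum_nonempty:
  fixes S :: "'i \<Rightarrow> 'v::comm_monoid_add set"
  assumes "finite I" "\<And>i. i \<in> I \<Longrightarrow> S i \<noteq> {}"
  shows "sum S I \<noteq> {}"
proof -
  have "\<forall>i\<in>I. \<exists>y. y \<in> S i"
    using assms(2) by blast
  then obtain y where "\<forall>i\<in>I. y i \<in> S i"
    by metis
  then have "sum y I \<in> sum S I"
    using assms(1) by (auto simp: mem_set_sum_iff)
  then show ?thesis
    by blast
qed

text \<open>
  Translating both sets to contain the origin reduces this to the dimension formula for the sum of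
  two subspaces.
\<close>

lemma aff_dim_set_plus_le:
  fixes S T :: "'v::euclidean_space set"
  assumes "S \<noteq> {}" "T \<noteq> {}"
  shows "aff_dim (S + T) \<le> aff_dim S + aff_dim T"
proof -
  obtain s t where st: "s \<in> S" "t \<in> T"
    using assms by blast
  let ?S = "(+) (- s) ` S" and ?T = "(+) (- t) ` T"
  let ?U = "{x + y | x y. x \<in> span ?S \<and> y \<in> span ?T}"
  have "(+) (- (s + t)) ` (S + T) \<subseteq> ?U"
  proof
    fix z assume "z \<in> (+) (- (s + t)) ` (S + T)"
    then obtain x y where xy: "x \<in> S" "y \<in> T" "z = - (s + t) + (x + y)"
      by (auto elim!: set_plus_elim)
    then have "z = (- s + x) + (- t + y)"
      by simp
    then show "z \<in> ?U"
      using xy by (blast intro: span_base)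
  qed
  then have "dim ((+) (- (s + t)) ` (S + T)) \<le> dim ?U"
    by (rule dim_subset)
  also have "\<dots> \<le> dim (span ?S) + dim (span ?T)"
    using dim_sums_Int[OF subspace_span subspace_span, of ?S ?T] by linarith
  also have "\<dots> = dim ?S + dim ?T"
    by simp
  finally have "int (dim ((+) (- (s + t)) ` (S + T))) \<le> int (dim ?S) + int (dim ?T)"
    by linarith
  moreover have "s \<in> affine hull S" "t \<in> affine hull T" "s + t \<in> affine hull (S + T)"
    using st by (auto intro: hull_inc)
  ultimately show ?thesis
    using aff_dim_eq_dim[of s S] aff_dim_eq_dim[of t T] aff_dim_eq_dim[of "s + t" "S + T"]
    by linarith
qed

lemma aff_dim_set_sum_le:
  fixes S :: "'i \<Rightarrow> 'v::euclidean_space set"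
  assumes "finite I" "\<And>i. i \<in> I \<Longrightarrow> S i \<noteq> {}"
  shows "aff_dim (sum S I) \<le> (\<Sum>i\<in>I. aff_dim (S i))"
  using assms
proof (induction rule: finite_induct)
  case empty
  then show ?case
    by (simp add: set_zero)
next
  case (insert i I)
  then have "aff_dim (S i + sum S I) \<le> aff_dim (S i) + aff_dim (sum S I)"
    by (intro aff_dim_set_plus_le set_sum_nonempty) auto
  with insert show ?case
    by force
qed

lemma dim_span_lattice:
  assumes "lattice_of_rank n M"
  shows "dim (span M) = n"
proof -
  from assms obtain E where E: "independent E" "card E = n"
      and M: "M = {\<Sum>e\<in>E. of_int (c e) *\<^sub>R e | c :: 'a \<Rightarrow> int. True}"
    unfolding lattice_of_rank_def by blast
  have "finite E"
    using E(1) by (rule independent_imp_finite)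
  have "E \<subseteq> M"
  proof
    fix e assume "e \<in> E"
    then have "e = (\<Sum>e'\<in>E. of_int (if e' = e then 1 else 0) *\<^sub>R e')"
      using \<open>finite E\<close> by (simp add: if_distrib[of of_int] if_distrib[of "\<lambda>r. r *\<^sub>R _"] sum.delta cong: if_cong)
    then show "e \<in> M"
      unfolding M by (intro CollectI exI[of _ "\<lambda>e'. if e' = e then 1 else 0"]) simp
  qed
  moreover have "M \<subseteq> span E"
    unfolding M by (auto intro!: span_sum span_scale intro: span_base)
  ultimately have "span M = span E"
    by (simp add: span_mono span_minimal subset_antisym)
  then show ?thesis
    using dim_eq_card_independent[OF E(1)] E(2) by simp
qed

text \<open>
  The affine hull of \<open>F\<close> is all of \<open>V\<close>, and \<open>V\<close> contains the origin, so the constant is zero.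
\<close>

lemma constant_inner_on_full_dim_set:
  fixes V :: "'v::euclidean_space set"
  assumes "subspace V" "F \<subseteq> V" "aff_dim F = int (dim V)"
    and const: "\<And>y. y \<in> F \<Longrightarrow> u \<bullet> y = c" and z: "z \<in> V"
  shows "u \<bullet> z = 0"
proof -
  have "F \<noteq> {}"
    using assms(3) by auto
  then have "affine hull F = V"
    using assms(1-3)
    by (intro affine_dim_equal) (auto simp: subspace_imp_affine hull_minimal aff_dim_subspace)
  moreover have "affine hull F \<subseteq> {y. u \<bullet> y = c}"
    using const by (intro hull_minimal) (auto simp: affine_hyperplane)
  ultimately have "V \<subseteq> {y. u \<bullet> y = c}"
    by simp
  moreover have "0 \<in> V"
    using assms(1) by (rule subspace_0)
  ultimately show ?thesis
    using z by (metis (mono_tags, lifting) inner_zero_right mem_Collect_eq subset_iff)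
qed

lemma one_dim_polytope_is_segment:
  fixes S :: "'v::euclidean_space set"
  assumes "polytope S" "aff_dim S = 1"
  shows "\<exists>a b. a \<noteq> b \<and> S = closed_segment a b"
proof -
  have "S \<noteq> {}"
    using assms(2) by auto
  moreover have "collinear S"
    using assms(2) by (simp add: collinear_aff_dim)
  ultimately obtain a b where ab: "S = closed_segment a b"
    using compact_convex_collinear_segment polytope_imp_compact[OF assms(1)]
      polytope_imp_convex[OF assms(1)] by blast
  then have "a \<noteq> b"
    using assms(2) by auto
  with ab show ?thesis
    by blast
qed


section \<open>Cells of an inf-convolution\<close>

lemma inf_conv_cong:
  assumes "\<And>i. i \<le> s \<Longrightarrow> P i = P' i" "\<And>i x. i \<le> s \<Longrightarrow> x \<in> P i \<Longrightarrow> \<rho> i x = \<rho>' i x"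
  shows "inf_conv s P \<rho> x = inf_conv s P' \<rho>' x"
proof -
  have "(\<Sum>i\<le>s. \<rho> i (y i)) = (\<Sum>i\<le>s. \<rho>' i (y i))" if "\<forall>i\<le>s. y i \<in> P' i" for y
    using that assms by (intro sum.cong) auto
  then have "{\<Sum>i\<le>s. \<rho> i (y i) |y. (\<forall>i\<le>s. y i \<in> P' i) \<and> (\<Sum>i\<le>s. y i) = x} =
      {\<Sum>i\<le>s. \<rho>' i (y i) |y. (\<forall>i\<le>s. y i \<in> P' i) \<and> (\<Sum>i\<le>s. y i) = x}"
    by (intro Collect_cong ex_cong1) auto
  then show ?thesis
    using assms(1) unfolding inf_conv_def by simp
qed

text \<open>
  The Minkowski sum of the polytopes above the summands lies above the sum of the \<open>P i\<close>, and its
  lower boundary is the inf-convolution: a decomposition of a lowest point of the sum can be pushed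
  down summand by summand without leaving the sum, so it already consists of points on the graphs.
\<close>

lemma inf_conv_least:
  assumes "\<And>i. i \<le> s \<Longrightarrow> polytopal_function (P i) (\<rho> i)"
  shows inf_conv_attained: "x \<in> (\<Sum>i\<le>s. P i) \<Longrightarrow>
      \<exists>y. (\<forall>i\<le>s. y i \<in> P i) \<and> (\<Sum>i\<le>s. y i) = x \<and> inf_conv s P \<rho> x = (\<Sum>i\<le>s. \<rho> i (y i))"
    and inf_conv_le: "\<And>y. (\<forall>i\<le>s. y i \<in> P i) \<Longrightarrow> inf_conv s P \<rho> (\<Sum>i\<le>s. y i) \<le> (\<Sum>i\<le>s. \<rho> i (y i))"
    and polytopal_function_inf_conv: "polytopal_function (\<Sum>i\<le>s. P i) (inf_conv s P \<rho>)"
proof -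
  have "\<forall>i\<in>{..s}. \<exists>Q. polytope Q \<and> Q \<noteq> {} \<and> fst ` Q = P i \<and>
        (\<forall>x\<in>P i. (x, \<rho> i x) \<in> Q \<and> (\<forall>t. (x, t) \<in> Q \<longrightarrow> \<rho> i x \<le> t))"
    using assms unfolding polytopal_function_def by blast
  then obtain Q where Q: "\<And>i. i \<le> s \<Longrightarrow> polytope (Q i) \<and> Q i \<noteq> {} \<and> fst ` Q i = P i \<and>
        (\<forall>x\<in>P i. (x, \<rho> i x) \<in> Q i \<and> (\<forall>t. (x, t) \<in> Q i \<longrightarrow> \<rho> i x \<le> t))"
    by (metis atMost_iff)
  define R where "R = sum Q {..s}"
  have "polytope R"
    unfolding R_def using Q by (intro polytope_set_sum) auto
  moreover have "R \<noteq> {}"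
    unfolding R_def using Q by (intro set_sum_nonempty) auto
  ultimately have R: "polytope R" "R \<noteq> {}"
    by auto
  have lift: "(\<Sum>i\<le>s. y i, \<Sum>i\<le>s. \<rho> i (y i)) \<in> R" if "\<forall>i\<le>s. y i \<in> P i" for y
    unfolding R_def mem_set_sum_iff[OF finite_atMost]
    using that Q by (intro exI[of _ "\<lambda>i. (y i, \<rho> i (y i))"]) (auto simp: sum_prod)
  (* Push each summand of a point of the sum down to the graph below it. *)
  have descend: "\<exists>y. (\<forall>i\<le>s. y i \<in> P i) \<and> (\<Sum>i\<le>s. y i) = x \<and> (\<Sum>i\<le>s. \<rho> i (y i)) \<le> t"
    if xt: "(x, t) \<in> R" for x t
  proof -
    obtain q where q: "\<And>i. i \<le> s \<Longrightarrow> q i \<in> Q i" "sum q {..s} = (x, t)"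
      using xt unfolding R_def by (auto simp: mem_set_sum_iff)
    have "fst (q i) \<in> P i \<and> \<rho> i (fst (q i)) \<le> snd (q i)" if "i \<le> s" for i
    proof -
      have "fst (q i) \<in> P i"
        using Q[OF that] q(1)[OF that] by blast
      moreover have "(fst (q i), snd (q i)) \<in> Q i"
        using q(1)[OF that] by simp
      ultimately show ?thesis
        using Q[OF that] by blast
    qed
    then show ?thesis
      using q(2) fst_sum[of q "{..s}"] snd_sum[of q "{..s}"]
      by (intro exI[of _ "\<lambda>i. fst (q i)"]) (auto intro!: sum_mono)
  qed
  have least: "\<exists>y. (\<forall>i\<le>s. y i \<in> P i) \<and> (\<Sum>i\<le>s. y i) = x \<and> inf_conv s P \<rho> x = (\<Sum>i\<le>s. \<rho> i (y i))
      \<and> (\<forall>t. (x, t) \<in> R \<longrightarrow> inf_conv s P \<rho> x \<le> t)"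
    if y0: "\<forall>i\<le>s. y0 i \<in> P i" "(\<Sum>i\<le>s. y0 i) = x" for x y0
  proof -
    obtain z where z: "(x, z) \<in> R" "\<And>t. (x, t) \<in> R \<Longrightarrow> z \<le> t"
      using compact_fibre_has_least[OF polytope_imp_compact[OF R(1)]] lift[OF y0(1)] y0(2)
      by blast
    obtain y where y: "\<forall>i\<le>s. y i \<in> P i" "(\<Sum>i\<le>s. y i) = x" "(\<Sum>i\<le>s. \<rho> i (y i)) \<le> z"
      using descend[OF z(1)] by blast
    have "(\<Sum>i\<le>s. \<rho> i (y i)) = z"
      using z(2)[of "\<Sum>i\<le>s. \<rho> i (y i)"] lift[OF y(1)] y(2,3) by simp
    moreover have "inf_conv s P \<rho> x = z"
      unfolding inf_conv_def
    proof (rule cInf_eq_minimum)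
      show "z \<in> {\<Sum>i\<le>s. \<rho> i (y i) |y. (\<forall>i\<le>s. y i \<in> P i) \<and> (\<Sum>i\<le>s. y i) = x}"
        using calculation y by blast
    qed (use z(2) lift in blast)
    ultimately show ?thesis
      using y z(2) by metis
  qed
  have PR: "x \<in> (\<Sum>i\<le>s. P i) \<longleftrightarrow> (\<exists>y. (\<forall>i\<le>s. y i \<in> P i) \<and> (\<Sum>i\<le>s. y i) = x)" for x
    by (auto simp: mem_set_sum_iff)
  show att: "\<exists>y. (\<forall>i\<le>s. y i \<in> P i) \<and> (\<Sum>i\<le>s. y i) = x \<and> inf_conv s P \<rho> x = (\<Sum>i\<le>s. \<rho> i (y i))"
    if "x \<in> (\<Sum>i\<le>s. P i)" for x
    using least that unfolding PR by blast
  show "inf_conv s P \<rho> (\<Sum>i\<le>s. y i) \<le> (\<Sum>i\<le>s. \<rho> i (y i))" if "\<forall>i\<le>s. y i \<in> P i" for y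
    using least[OF that refl] lift[OF that] by blast
  show "polytopal_function (\<Sum>i\<le>s. P i) (inf_conv s P \<rho>)"
    unfolding polytopal_function_def
  proof (intro exI[of _ R] conjI R ballI allI impI)
    show "fst ` R = (\<Sum>i\<le>s. P i)"
    proof (intro subset_antisym subsetI)
      fix x assume "x \<in> fst ` R"
      then obtain t where "(x, t) \<in> R"
        by auto
      then show "x \<in> (\<Sum>i\<le>s. P i)"
        using descend unfolding PR by blast
    next
      fix x assume "x \<in> (\<Sum>i\<le>s. P i)"
      then show "x \<in> fst ` R"
        using lift unfolding PR by (metis fst_conv image_eqI)
    qed
    fix x assume x: "x \<in> (\<Sum>i\<le>s. P i)"
    show "(x, inf_conv s P \<rho> x) \<in> R"
      using att[OF x] lift by metis
    fix t assume "(x, t) \<in> R"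
    then show "inf_conv s P \<rho> x \<le> t"
      using least x unfolding PR by blast
  qed
qed

text \<open>
  A sum \<open>\<Sum>i\<le>s. \<rho> i (y i) + v \<bullet> y i\<close> is minimal iff each of its terms is, so minimising the
  inf-convolution plus \<open>v\<close> amounts to minimising each \<open>\<rho> i\<close> plus \<open>v\<close> separately.
\<close>

lemma cell_inf_conv:
  assumes poly: "\<And>i. i \<le> s \<Longrightarrow> polytopal_function (P i) (\<rho> i)"
  shows cell_inf_conv_eq_sum: "cell (\<Sum>i\<le>s. P i) (inf_conv s P \<rho>) v = (\<Sum>i\<le>s. cell (P i) (\<rho> i) v)"
    and component_cell: "i \<le> s \<Longrightarrow>
      component s P \<rho> (cell (\<Sum>i\<le>s. P i) (inf_conv s P \<rho>) v) i = cell (P i) (\<rho> i) v"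
proof -
  let ?C = "\<lambda>i. cell (P i) (\<rho> i) v"
  let ?f = "\<lambda>y. \<Sum>i\<le>s. \<rho> i (y i) + v \<bullet> y i"
  have f: "?f y = (\<Sum>i\<le>s. \<rho> i (y i)) + v \<bullet> (\<Sum>i\<le>s. y i)" for y
    by (simp add: sum.distrib inner_sum_right)
  have "\<forall>i\<in>{..s}. \<exists>y. y \<in> ?C i"
    using cell_nonempty[OF poly] by blast
  then obtain y0 where y0: "\<And>i. i \<le> s \<Longrightarrow> y0 i \<in> ?C i"
    by (metis atMost_iff)
  have ge: "?f y0 \<le> ?f y" if "\<forall>i\<le>s. y i \<in> P i" for y
    using that y0 by (intro sum_mono) (auto simp: cell_def)
  have eq: "?f y = ?f y0" if "\<And>i. i \<le> s \<Longrightarrow> y i \<in> ?C i" for y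
    using that y0 by (intro sum.cong) (fastforce simp: cell_def)+
  (* A total equal to the sum of the minima leaves no slack in any single term. *)
  have tight_sum: "y i \<in> ?C i" if y: "\<forall>i\<le>s. y i \<in> P i" and "?f y \<le> ?f y0" and i: "i \<le> s" for y i
  proof -
    have "\<rho> j (y0 j) + v \<bullet> y0 j \<le> \<rho> j (y j) + v \<bullet> y j" if "j \<le> s" for j
      using y y0[OF that] that by (auto simp: cell_def)
    moreover have "?f y = ?f y0"
      using ge[OF y] that(2) by linarith
    ultimately have "\<rho> i (y0 i) + v \<bullet> y0 i = \<rho> i (y i) + v \<bullet> y i"
      using sum_mono_inv[of "\<lambda>i. \<rho> i (y0 i) + v \<bullet> y0 i" "{..s}" "\<lambda>i. \<rho> i (y i) + v \<bullet> y i" i] i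
      by auto
    then show ?thesis
      using y0[OF i] y i by (auto simp: cell_def)
  qed
  have sum_ge: "?f y0 \<le> inf_conv s P \<rho> x + v \<bullet> x" if "x \<in> (\<Sum>i\<le>s. P i)" for x
    using inf_conv_attained[OF poly that] ge f by metis
  have sum_le: "inf_conv s P \<rho> (\<Sum>i\<le>s. y i) + v \<bullet> (\<Sum>i\<le>s. y i) \<le> ?f y" if "\<forall>i\<le>s. y i \<in> P i" for y
    using inf_conv_le[OF poly that] f[of y] by simp
  have y0P: "\<forall>i\<le>s. y0 i \<in> P i"
    using y0 by (auto simp: cell_def)
  then have y0_sum: "(\<Sum>i\<le>s. y0 i) \<in> (\<Sum>i\<le>s. P i)"
    by (auto simp: mem_set_sum_iff)
  have cell_iff: "x \<in> cell (\<Sum>i\<le>s. P i) (inf_conv s P \<rho>) v \<longleftrightarrow>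
      x \<in> (\<Sum>i\<le>s. P i) \<and> inf_conv s P \<rho> x + v \<bullet> x \<le> ?f y0" for x
    using sum_le[OF y0P] sum_ge y0_sum unfolding cell_def by force
  have mem_cell: "(\<Sum>i\<le>s. y i) \<in> cell (\<Sum>i\<le>s. P i) (inf_conv s P \<rho>) v \<and>
      inf_conv s P \<rho> (\<Sum>i\<le>s. y i) = (\<Sum>i\<le>s. \<rho> i (y i))" if y: "\<And>i. i \<le> s \<Longrightarrow> y i \<in> ?C i" for y
  proof -
    have P: "\<forall>i\<le>s. y i \<in> P i"
      using y by (auto simp: cell_def)
    then have "(\<Sum>i\<le>s. y i) \<in> (\<Sum>i\<le>s. P i)"
      by (auto simp: mem_set_sum_iff)
    then show ?thesis
      unfolding cell_iff using sum_le[OF P] sum_ge[of "\<Sum>i\<le>s. y i"] eq[OF y] f[of y] by auto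
  qed
  show "cell (\<Sum>i\<le>s. P i) (inf_conv s P \<rho>) v = (\<Sum>i\<le>s. ?C i)"
  proof (intro subset_antisym subsetI)
    fix x assume x: "x \<in> cell (\<Sum>i\<le>s. P i) (inf_conv s P \<rho>) v"
    then have "x \<in> (\<Sum>i\<le>s. P i)"
      unfolding cell_iff by blast
    from inf_conv_attained[OF poly this]
    obtain y where y: "\<forall>i\<le>s. y i \<in> P i" "(\<Sum>i\<le>s. y i) = x"
        "inf_conv s P \<rho> x = (\<Sum>i\<le>s. \<rho> i (y i))"
      by blast
    then have "?f y \<le> ?f y0"
      using x f[of y] unfolding cell_iff by simp
    then show "x \<in> (\<Sum>i\<le>s. ?C i)"
      using tight_sum[OF y(1)] y(2) by (auto simp: mem_set_sum_iff)
  next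
    fix x assume "x \<in> (\<Sum>i\<le>s. ?C i)"
    then show "x \<in> cell (\<Sum>i\<le>s. P i) (inf_conv s P \<rho>) v"
      using mem_cell by (auto simp: mem_set_sum_iff)
  qed
  show "component s P \<rho> (cell (\<Sum>i\<le>s. P i) (inf_conv s P \<rho>) v) i = ?C i" if i: "i \<le> s"
  proof (intro subset_antisym subsetI)
    fix x assume "x \<in> component s P \<rho> (cell (\<Sum>i\<le>s. P i) (inf_conv s P \<rho>) v) i"
    then obtain y where y: "x = y i" "\<forall>i\<le>s. y i \<in> P i"
        "(\<Sum>i\<le>s. y i) \<in> cell (\<Sum>i\<le>s. P i) (inf_conv s P \<rho>) v"
        "inf_conv s P \<rho> (\<Sum>i\<le>s. y i) = (\<Sum>i\<le>s. \<rho> i (y i))"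
      unfolding component_def by blast
    then have "?f y \<le> ?f y0"
      using f[of y] unfolding cell_iff by simp
    then show "x \<in> ?C i"
      using tight_sum[OF y(2) _ i] y(1) by blast
  next
    fix x assume x: "x \<in> ?C i"
    define y where "y = y0(i := x)"
    have y: "y j \<in> ?C j" if "j \<le> s" for j
      using y0[OF that] x by (simp add: y_def)
    have "\<forall>i\<le>s. y i \<in> P i"
      using y by (auto simp: cell_def)
    moreover have "x = y i"
      by (simp add: y_def)
    ultimately show "x \<in> component s P \<rho> (cell (\<Sum>i\<le>s. P i) (inf_conv s P \<rho>) v) i"
      unfolding component_def using mem_cell[OF y] by blast
  qed
qed

lemma cell_zero_set_sum:
  fixes P :: "'i \<Rightarrow> 'v::euclidean_space set"
  assumes I: "finite I" and poly: "\<And>i. i \<in> I \<Longrightarrow> polytope (P i) \<and> P i \<noteq> {}"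
  shows "cell (sum P I) (\<lambda>_. 0) v = (\<Sum>i\<in>I. cell (P i) (\<lambda>_. 0) v)"
proof -
  let ?C = "\<lambda>i. cell (P i) (\<lambda>_. 0) v"
  have "\<forall>i\<in>I. \<exists>y. y \<in> ?C i"
    using cell_nonempty[OF polytopal_function_zero] poly by blast
  then obtain y0 where y0: "\<And>i. i \<in> I \<Longrightarrow> y0 i \<in> ?C i"
    by metis
  show ?thesis
  proof (intro subset_antisym subsetI)
    fix x assume x: "x \<in> cell (sum P I) (\<lambda>_. 0) v"
    then obtain y where y: "\<forall>i\<in>I. y i \<in> P i" "sum y I = x"
      using I by (auto simp: cell_def mem_set_sum_iff)
    have ge: "v \<bullet> y0 i \<le> v \<bullet> y i" if "i \<in> I" for i
      using y y0[OF that] that by (auto simp: cell_def)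
    have "sum y0 I \<in> sum P I"
      using I y0 by (auto simp: cell_def mem_set_sum_iff)
    then have "(\<Sum>i\<in>I. v \<bullet> y i) \<le> (\<Sum>i\<in>I. v \<bullet> y0 i)"
      using x y(2) by (auto simp: cell_def inner_sum_right[symmetric])
    then have "(\<Sum>i\<in>I. v \<bullet> y0 i) = (\<Sum>i\<in>I. v \<bullet> y i)"
      using ge by (meson antisym sum_mono)
    then have "v \<bullet> y0 i = v \<bullet> y i" if "i \<in> I" for i
      using sum_mono_inv[of "\<lambda>i. v \<bullet> y0 i" I "\<lambda>i. v \<bullet> y i" i] ge that I by blast
    then have "\<forall>i\<in>I. y i \<in> ?C i"
      using y(1) y0 by (fastforce simp: cell_def)
    then show "x \<in> sum ?C I"
      using I y(2) by (auto simp: mem_set_sum_iff)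
  next
    fix x assume "x \<in> sum ?C I"
    then obtain y where y: "\<forall>i\<in>I. y i \<in> ?C i" "sum y I = x"
      using I by (auto simp: mem_set_sum_iff)
    have "v \<bullet> x \<le> v \<bullet> z" if "z \<in> sum P I" for z
    proof -
      obtain w where w: "\<forall>i\<in>I. w i \<in> P i" "sum w I = z"
        using I \<open>z \<in> sum P I\<close> by (auto simp: mem_set_sum_iff)
      then show ?thesis
        using y by (auto simp: inner_sum_right cell_def intro!: sum_mono)
    qed
    moreover have "x \<in> sum P I"
      using y I by (auto simp: mem_set_sum_iff cell_def)
    ultimately show "x \<in> cell (sum P I) (\<lambda>_. 0) v"
      by (simp add: cell_def)
  qed
qed

lemma coarser_trans:
  assumes "coarser s P \<rho> \<sigma>" "coarser s P \<sigma> \<tau>"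
  shows "coarser s P \<rho> \<tau>"
  unfolding coarser_def
proof
  fix C assume "C \<in> mixed_subdivision s P \<tau>"
  then obtain D where D: "D \<in> mixed_subdivision s P \<sigma>" "C \<subseteq> D"
      "\<forall>i\<le>s. component s P \<tau> C i \<subseteq> component s P \<sigma> D i"
    using assms(2) unfolding coarser_def by blast
  then obtain E where "E \<in> mixed_subdivision s P \<rho>" "D \<subseteq> E"
      "\<forall>i\<le>s. component s P \<sigma> D i \<subseteq> component s P \<rho> E i"
    using assms(1) unfolding coarser_def by blast
  note E = this
  have "C \<subseteq> E"
    using D(2) E(2) by (rule subset_trans)
  moreover have "component s P \<tau> C i \<subseteq> component s P \<rho> E i" if "i \<le> s" for i
    using subset_trans[OF D(3)[rule_format, OF that] E(3)[rule_format, OF that]] .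
  ultimately show "\<exists>E\<in>mixed_subdivision s P \<rho>. C \<subseteq> E \<and>
      (\<forall>i\<le>s. component s P \<tau> C i \<subseteq> component s P \<rho> E i)"
    using E(1) by (intro bexI[of _ E]) auto
qed

lemma coarser_refl: "coarser s P \<rho> \<rho>"
  unfolding coarser_def
proof
  fix C assume "C \<in> mixed_subdivision s P \<rho>"
  then show "\<exists>D\<in>mixed_subdivision s P \<rho>. C \<subseteq> D \<and>
      (\<forall>i\<le>s. component s P \<rho> C i \<subseteq> component s P \<rho> D i)"
    by (rule bexI[rotated]) simp
qed

text \<open>
  Subdivisions and components see the functions only through their values on the polytopes.
\<close>

lemma coarser_cong:
  assumes "\<And>i x. i \<le> s \<Longrightarrow> x \<in> P i \<Longrightarrow> \<rho> i x = \<rho>' i x" "\<And>i x. i \<le> s \<Longrightarrow> x \<in> P i \<Longrightarrow> \<sigma> i x = \<sigma>' i x"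
  shows "coarser s P \<rho> \<sigma> = coarser s P \<rho>' \<sigma>'"
proof -
  have eq: "inf_conv s P f = inf_conv s P g \<and> component s P f = component s P g"
    if fg: "\<And>i x. i \<le> s \<Longrightarrow> x \<in> P i \<Longrightarrow> f i x = g i x" for f g
  proof -
    have ic: "inf_conv s P f = inf_conv s P g"
      using fg by (intro ext inf_conv_cong) auto
    have "(\<Sum>j\<le>s. f j (y j)) = (\<Sum>j\<le>s. g j (y j))" if "\<forall>j\<le>s. y j \<in> P j" for y
      using that fg by (intro sum.cong) auto
    then have "component s P f C i = component s P g C i" for C i
      unfolding component_def ic by (intro Collect_cong ex_cong1) auto
    with ic show ?thesis
      by blast
  qed
  have eqs: "inf_conv s P \<rho> = inf_conv s P \<rho>'" "component s P \<rho> = component s P \<rho>'"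
      "inf_conv s P \<sigma> = inf_conv s P \<sigma>'" "component s P \<sigma> = component s P \<sigma>'"
    using eq[of \<rho> \<rho>', OF assms(1)] eq[of \<sigma> \<sigma>', OF assms(2)] by blast+
  show ?thesis
    unfolding coarser_def mixed_subdivision_def by (simp only: eqs)
qed


section \<open>Generic points\<close>

text \<open>
  The points of a cell that minimise \<open>u\<close> on it form a cell again, that of \<open>v + \<epsilon> u\<close> with \<open>\<epsilon>\<close> small.
  When it contains \<open>x\<close>, genericity makes it full-dimensional, and \<open>u\<close> is constant on it.
\<close>

lemma generic_point_minimises_only_trivially:
  fixes V :: "'v::euclidean_space set"
  assumes poly: "polytopal_function P \<rho>" and V: "subspace V" "P \<subseteq> V"
    and generic: "\<And>C. C \<in> subdivision P \<rho> \<Longrightarrow> x \<in> C \<Longrightarrow> aff_dim C = int (dim V)"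
    and x: "x \<in> cell P \<rho> v" and min: "\<And>y. y \<in> cell P \<rho> v \<Longrightarrow> u \<bullet> x \<le> u \<bullet> y"
    and z: "z \<in> V"
  shows "u \<bullet> z = 0"
proof -
  obtain \<epsilon> :: real where \<epsilon>: "\<epsilon> > 0" "cell P \<rho> (v + \<epsilon> *\<^sub>R u) \<subseteq> cell P \<rho> v"
    using small_perturbation_refines_cell[OF poly] by blast
  let ?F = "cell P \<rho> (v + \<epsilon> *\<^sub>R u)"
  have *: "u \<bullet> y = u \<bullet> x \<and> x \<in> ?F" if y: "y \<in> ?F" for y
  proof -
    have yC: "y \<in> cell P \<rho> v"
      using y \<epsilon>(2) by blast
    have "x \<in> P" "y \<in> P"
      using x y by (auto simp: cell_def)
    then have eq: "\<rho> y + v \<bullet> y = \<rho> x + v \<bullet> x"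
      using x yC by (force simp: cell_def)
    moreover have le: "\<rho> y + (v + \<epsilon> *\<^sub>R u) \<bullet> y \<le> \<rho> z + (v + \<epsilon> *\<^sub>R u) \<bullet> z" if "z \<in> P" for z
      using y that by (simp add: cell_def)
    ultimately have "\<epsilon> * (u \<bullet> y) \<le> \<epsilon> * (u \<bullet> x)"
      using le[OF \<open>x \<in> P\<close>] by (simp add: inner_add_left)
    then have uy: "u \<bullet> y = u \<bullet> x"
      using \<epsilon>(1) min[OF yC] by simp
    then have "\<rho> x + (v + \<epsilon> *\<^sub>R u) \<bullet> x = \<rho> y + (v + \<epsilon> *\<^sub>R u) \<bullet> y"
      using eq by (simp add: inner_add_left)
    then have "x \<in> ?F"
      using le \<open>x \<in> P\<close> by (simp add: cell_def)
    with uy show ?thesis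
      by blast
  qed
  have "aff_dim ?F = int (dim V)"
    using * cell_nonempty[OF poly] generic[of ?F] by (auto simp: subdivision_def)
  moreover have "?F \<subseteq> V"
    using V(2) by (auto simp: cell_def)
  ultimately show ?thesis
    using constant_inner_on_full_dim_set[OF V(1)] * z by metis
qed

text \<open>
  If \<open>d\<close> and \<open>e\<close> select \<open>D\<close> and \<open>E\<close>, then \<open>d - e\<close> attains its minimum over \<open>E \<supseteq> C\<close> at \<open>x\<close>, hence
  vanishes on \<open>V\<close>. With \<open>\<sigma> = \<rho>\<close> and \<open>E = C\<close> this says that \<open>C\<close> is the only cell of \<open>\<rho>\<close> containing
  \<open>x\<close>.
\<close>

lemma generic_point_in_unique_coarse_cell:
  fixes V :: "'v::euclidean_space set"
  assumes poly: "polytopal_function P \<rho>" and V: "subspace V" "P \<subseteq> V"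
    and generic: "\<And>C. C \<in> subdivision P \<rho> \<Longrightarrow> x \<in> C \<Longrightarrow> aff_dim C = int (dim V)"
    and C: "C \<in> subdivision P \<rho>" "x \<in> C"
    and D: "D \<in> subdivision P \<sigma>" "x \<in> D"
    and E: "E \<in> subdivision P \<sigma>" "C \<subseteq> E"
  shows "D = E"
proof -
  obtain v d e where [simp]: "C = cell P \<rho> v" "D = cell P \<sigma> d" "E = cell P \<sigma> e"
    using C(1) D(1) E(1) by (auto simp: subdivision_def)
  have "(d - e) \<bullet> x \<le> (d - e) \<bullet> y" if "y \<in> C" for y
  proof -
    have "y \<in> E" "x \<in> E"
      using that C(2) E(2) by auto
    then have "\<sigma> y + e \<bullet> y = \<sigma> x + e \<bullet> x"
      by (force simp: cell_def)
    moreover have "\<sigma> x + d \<bullet> x \<le> \<sigma> y + d \<bullet> y"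
      using D(2) \<open>y \<in> E\<close> by (simp add: cell_def)
    ultimately show ?thesis
      by (simp add: inner_diff_left)
  qed
  then have min: "(d - e) \<bullet> x \<le> (d - e) \<bullet> y" if "y \<in> cell P \<rho> v" for y
    using that by simp
  have "(d - e) \<bullet> z = 0" if "z \<in> P" for z
  proof (rule generic_point_minimises_only_trivially[OF poly V _ _ min])
    show "x \<in> cell P \<rho> v" "z \<in> V"
      using C(2) that V(2) by auto
  qed (rule generic)
  then have "d \<bullet> z = e \<bullet> z" if "z \<in> P" for z
    using that by (simp add: inner_diff_left)
  then show ?thesis
    by (auto simp: cell_def)
qed


section \<open>Families containing a monomial\<close>

text \<open>
  The \<open>i\<close>-th polynomial is a monomial with nonzero coefficient, and such a monomial has no zero in the
  torus. So the incidence variety is empty, its image is not a hypersurface, and the resultant is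
  \<open>1\<close> or \<open>-1\<close>. The case \<open>A i = {}\<close> is covered as well: no nonzero coefficient vector exists then.
\<close>

lemma fundamental_indices_eq_empty:
  fixes M :: "'v::euclidean_space set"
  assumes i: "i \<le> n" and A: "A i \<subseteq> {a}" "A i \<subseteq> M"
  shows "fundamental_indices M n A = {}"
proof -
  have "(t, u) \<notin> incidence M n A" for t u
  proof
    assume "(t, u) \<in> incidence M n A"
    then have *: "\<forall>a\<in>M. t a \<noteq> 0" "\<exists>a\<in>A i. u (i, a) \<noteq> 0" "(\<Sum>a\<in>A i. u (i, a) * t a) = 0"
      using i by (auto simp: incidence_def torus_def proj_coords_def)
    then have "A i = {a}"
      using A(1) by blast
    with * A(2) show False
      by auto
  qed
  then have "incidence M n A = {}"
    by auto
  moreover have "multihomogeneous n A (1 :: ('v, complex) upoly)"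
    by (auto simp: multihomogeneous_def indets_def)
  moreover have "eval_upoly u (1 :: ('v, complex) upoly) \<noteq> 0" for u
    by (simp add: eval_upoly_def)
  ultimately have "proj_image M n A = {}"
    by (auto simp: proj_image_def zariski_closure_def zero_locus_def)
  (* An empty set is not a hypersurface, so only the second branch of the definition remains. *)
  then have iff: "is_sparse_resultant M n A R \<longleftrightarrow> R = 1 \<or> R = - 1" for R
    by (simp add: is_sparse_resultant_def hypersurface_def)
  have "is_sparse_resultant M n A (sparse_resultant M n A)"
    unfolding sparse_resultant_def by (rule someI[where x = 1]) (simp add: iff)
  then have "sparse_resultant M n A = 1 \<or> sparse_resultant M n A = - 1"
    by (simp only: iff)
  then have "indets (sparse_resultant M n A) = {}"
    by (auto simp: indets_def)
  then show ?thesis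
    unfolding fundamental_indices_def by (intro Least_equality) auto
qed


section \<open>Mixed cells over a tight coarse cell\<close>

text \<open>
  Replacing the supports from \<open>k\<close> on by their sum does not change the cells when the functions on
  these supports vanish, since a linear functional is minimal on a sum exactly on the sum of its
  minimal faces. Tightness of the regrouped family therefore constrains the original components.
\<close>

lemma tight_regroup:
  fixes P :: "nat \<Rightarrow> 'v::euclidean_space set"
  assumes \<theta>: "\<And>i. i \<le> n \<Longrightarrow> polytopal_function (P i) (\<theta> i)"
    and zero: "\<And>i x. i \<le> n \<Longrightarrow> k \<le> i \<Longrightarrow> x \<in> P i \<Longrightarrow> \<theta> i x = 0"
    and k: "k \<le> n"
    and P': "\<And>j. j < k \<Longrightarrow> P' j = P j" "P' k = (\<Sum>i\<in>{k..n}. P i)"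
    and \<theta>': "\<And>j x. j < k \<Longrightarrow> x \<in> P j \<Longrightarrow> \<theta>' j x = \<theta> j x" "\<And>x. x \<in> P' k \<Longrightarrow> \<theta>' k x = 0"
    and tight: "tight n k P' \<theta>'"
    and D: "D \<in> n_cells n n P \<theta>"
  shows "(\<Sum>i<k. aff_dim (component n P \<theta> D i))
        + aff_dim (\<Sum>i\<in>{k..n}. component n P \<theta> D i) = int n"
proof -
  obtain d where d: "D = cell (\<Sum>i\<le>n. P i) (inf_conv n P \<theta>) d"
    using D by (auto simp: n_cells_def mixed_subdivision_def subdivision_def)
  have polytope: "polytope (P i) \<and> P i \<noteq> {}" if "i \<le> n" for i
    using polytopal_function_imp_polytope[OF \<theta>[OF that]] cell_nonempty[OF \<theta>[OF that]]
    by (auto simp: cell_def)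
  have \<theta>'_poly: "polytopal_function (P' j) (\<theta>' j)" if "j \<le> k" for j
  proof (cases "j < k")
    case True
    have "polytopal_function (P j) (\<theta>' j)"
      using True k by (intro polytopal_function_cong[OF \<theta>]) (auto simp: \<theta>'(1))
    then show ?thesis
      using True P'(1) by simp
  next
    case False
    then have "j = k"
      using that by simp
    have "polytope (P' k)"
      unfolding P'(2) using polytope by (intro polytope_set_sum) auto
    moreover have "P' k \<noteq> {}"
      unfolding P'(2) using polytope by (intro set_sum_nonempty) auto
    ultimately show ?thesis
      unfolding \<open>j = k\<close> using \<theta>'(2)
      by (intro polytopal_function_cong[OF polytopal_function_zero]) auto
  qed
  have comp: "component n P \<theta> D i = cell (P i) (\<theta> i) d" if "i \<le> n" for i
    unfolding d by (rule component_cell[OF \<theta> that])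
  have low: "cell (P' j) (\<theta>' j) d = cell (P j) (\<theta> j) d" if "j < k" for j
    using \<theta>'(1)[OF that] P'(1)[OF that] by (auto simp: cell_def)
  have "cell (P' k) (\<theta>' k) d = cell (P' k) (\<lambda>_. 0) d"
    using \<theta>'(2) by (auto simp: cell_def)
  also have "\<dots> = (\<Sum>i\<in>{k..n}. cell (P i) (\<lambda>_. 0) d)"
    unfolding P'(2) using polytope by (intro cell_zero_set_sum) auto
  also have "\<dots> = (\<Sum>i\<in>{k..n}. cell (P i) (\<theta> i) d)"
    using zero by (intro sum.cong) (auto simp: cell_def)
  finally have high: "cell (P' k) (\<theta>' k) d = (\<Sum>i\<in>{k..n}. cell (P i) (\<theta> i) d)" .
  have split: "{..n} = {..<k} \<union> {k..n}" and split': "{..k} = insert k {..<k}"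
    using k by auto
  have "cell (\<Sum>j\<le>k. P' j) (inf_conv k P' \<theta>') d = (\<Sum>j\<le>k. cell (P' j) (\<theta>' j) d)"
    by (rule cell_inf_conv_eq_sum[OF \<theta>'_poly])
  also have "\<dots> = cell (P' k) (\<theta>' k) d + (\<Sum>j<k. cell (P' j) (\<theta>' j) d)"
    unfolding split' by (rule sum.insert) auto
  also have "\<dots> = (\<Sum>j<k. cell (P j) (\<theta> j) d) + (\<Sum>i\<in>{k..n}. cell (P i) (\<theta> i) d)"
    by (simp add: high low add.commute)
  also have "\<dots> = (\<Sum>i\<le>n. cell (P i) (\<theta> i) d)"
    unfolding split by (rule sum.union_disjoint[symmetric]) auto
  also have "\<dots> = D"
    unfolding d by (rule cell_inf_conv_eq_sum[OF \<theta>, symmetric])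
  finally have D': "cell (\<Sum>j\<le>k. P' j) (inf_conv k P' \<theta>') d = D" .
  then have "D \<in> n_cells n k P' \<theta>'"
    using D by (auto simp: n_cells_def mixed_subdivision_def subdivision_def)
  then have "(\<Sum>j\<le>k. aff_dim (component k P' \<theta>' D j)) = int n"
    using tight by (simp add: tight_def)
  moreover have "component k P' \<theta>' D j = cell (P' j) (\<theta>' j) d" if "j \<le> k" for j
    unfolding D'[symmetric] by (rule component_cell[OF \<theta>'_poly that])
  ultimately have "(\<Sum>j\<le>k. aff_dim (cell (P' j) (\<theta>' j) d)) = int n"
    by simp
  then show ?thesis
    using k comp by (simp add: split' high low)
qed

text \<open>
  The dimension count: \<open>c i\<close> and \<open>e i\<close> are the dimensions of the \<open>i\<close>-th components of the cell \<open>C\<close>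
  through \<open>b - \<delta>\<close> and of \<open>D\<close>. Tightness of \<open>D\<close> in the regrouped sense forces \<open>c i = e i\<close> for
  \<open>i < k\<close>, and these \<open>e i\<close> are nonzero by assumption; the \<open>c i\<close> with \<open>i > k\<close> are nonzero because \<open>b\<close>
  has index \<open>k\<close>. The \<open>c i\<close> with \<open>i \<noteq> k\<close> are then \<open>n\<close> positive integers with sum \<open>n\<close>, so all of them
  are equal to one.
\<close>

lemma index_points_lie_in_mixed_cells:
  fixes M :: "'v::euclidean_space set"
  assumes dimM: "dim (span M) = n"
    and P: "\<And>i. i \<le> n \<Longrightarrow> P i \<subseteq> span M"
    and \<rho>: "\<And>i. i \<le> n \<Longrightarrow> polytopal_function (P i) (\<rho> i)"
    and \<theta>: "\<And>i. i \<le> n \<Longrightarrow> polytopal_function (P i) (\<theta> i)"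
    and generic: "generic_translation M n P \<rho> \<delta>"
    and tight: "tight n n P \<rho>"
    and coarser: "coarser n P \<theta> \<rho>"
    and D: "D \<in> n_cells n n P \<theta>"
    and D_tight: "(\<Sum>i<k. aff_dim (component n P \<theta> D i))
        + aff_dim (\<Sum>i\<in>{k..n}. component n P \<theta> D i) \<le> int n"
    and D_pos: "\<And>i. i \<le> n \<Longrightarrow> i < k \<Longrightarrow> aff_dim (component n P \<theta> D i) \<noteq> 0"
    and b: "b \<in> lattice_points_of_index M n P \<rho> \<delta> k" "b \<in> translate D \<delta>"
  shows "\<exists>C \<in> n_cells n n (component n P \<theta> D) \<rho>.
      k_mixed n (component n P \<theta> D) \<rho> k C \<and> b \<in> translate C \<delta>"
proof -
  let ?P = "\<Sum>i\<le>n. P i" and ?\<rho> = "inf_conv n P \<rho>" and ?\<theta> = "inf_conv n P \<theta>"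
  let ?D = "component n P \<theta> D"
  define x where "x = b - \<delta>"
  have b_eq: "b \<in> translate S \<delta> \<longleftrightarrow> x \<in> S" for S
    unfolding x_def by (metis (no_types, lifting) add_diff_cancel diff_add_cancel image_iff)
  have bM: "b \<in> M"
    using b(1) by (simp add: lattice_points_of_index_def)
  have xD: "x \<in> D"
    using b(2) unfolding b_eq .
  have polyP: "polytopal_function ?P ?\<rho>"
    using \<rho> by (rule polytopal_function_inf_conv)
  have PM: "?P \<subseteq> span M"
    using P by (auto simp: mem_set_sum_iff intro!: span_sum) blast
  obtain d where d: "D = cell ?P ?\<theta> d"
    using D by (auto simp: n_cells_def mixed_subdivision_def subdivision_def)
  have xP: "x \<in> ?P"
    using xD d by (simp add: cell_def)
  have full: "aff_dim C = int (dim (span M))" if "C \<in> subdivision ?P ?\<rho>" "x \<in> C" for C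
  proof -
    have "C \<subseteq> span M"
      using that(1) PM by (auto simp: subdivision_def cell_def)
    then have "aff_dim C \<le> int n"
      using aff_dim_subset[of C "span M"] dimM by (simp add: aff_dim_subspace)
    moreover have "\<not> aff_dim C \<le> int n - 1"
    proof
      assume "aff_dim C \<le> int n - 1"
      then have "x \<in> \<Union>{C \<in> mixed_subdivision n P \<rho>. aff_dim C \<le> int n - 1}"
        using that by (auto simp: mixed_subdivision_def)
      then show False
        using generic bM b_eq unfolding generic_translation_def by blast
    qed
    ultimately show ?thesis
      using dimM by linarith
  qed
  have uniq: "E = E'" if "C \<in> subdivision ?P ?\<rho>" "x \<in> C" "E \<in> subdivision ?P \<sigma>" "x \<in> E"
      "E' \<in> subdivision ?P \<sigma>" "C \<subseteq> E'" for C E E' \<sigma>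
    by (rule generic_point_in_unique_coarse_cell[OF polyP subspace_span PM full that])
  obtain v where xC: "x \<in> cell ?P ?\<rho> v"
    using in_some_cell[OF polyP xP] by blast
  define C where "C = cell ?P ?\<rho> v"
  define c where "c i = aff_dim (cell (P i) (\<rho> i) v)" for i
  have C_sub: "C \<in> subdivision ?P ?\<rho>" and xC: "x \<in> C"
    using xC by (auto simp: C_def subdivision_def)
  have C_cell: "C \<in> n_cells n n P \<rho>"
    using C_sub full[OF C_sub xC] dimM by (simp add: n_cells_def mixed_subdivision_def)
  have comp: "component n P \<rho> C i = cell (P i) (\<rho> i) v" if "i \<le> n" for i
    unfolding C_def by (rule component_cell[OF \<rho> that])
  have nonempty: "cell (P i) (\<rho> i) v \<noteq> {}" if "i \<le> n" for i
    using cell_nonempty[OF \<rho>[OF that]] .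
  have "(THE C. C \<in> n_cells n n P \<rho> \<and> b \<in> translate C \<delta>) = C"
  proof (rule the_equality)
    fix E assume "E \<in> n_cells n n P \<rho> \<and> b \<in> translate E \<delta>"
    then show "E = C"
      using uniq[OF C_sub xC _ _ C_sub, of E] by (auto simp: n_cells_def mixed_subdivision_def b_eq)
  qed (use C_cell xC in \<open>simp add: b_eq\<close>)
  then have "Max {i. i \<le> n \<and> aff_dim (component n P \<rho> C i) = 0} = k"
    using b(1) by (simp add: lattice_points_of_index_def cell_index_def)
  then have Max: "Max {i. i \<le> n \<and> c i = 0} = k"
    by (metis (no_types, lifting) Collect_cong c_def comp)
  have c_nonneg: "0 \<le> c i" if "i \<le> n" for i
    using nonempty[OF that] by (simp add: c_def aff_dim_negative_iff flip: not_less)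
  have c_sum: "(\<Sum>i\<le>n. c i) = int n"
    using tight C_cell comp by (auto simp: tight_def c_def)
  (* n + 1 dimensions with sum n cannot all be positive, so the index k is a genuine maximum. *)
  have "\<exists>i\<le>n. c i = 0"
  proof (rule ccontr)
    assume "\<not> ?thesis"
    then have "1 \<le> c i" if "i \<le> n" for i
      using c_nonneg[OF that] that by force
    then have "(\<Sum>i\<le>n. 1) \<le> (\<Sum>i\<le>n. c i)"
      by (intro sum_mono) auto
    then show False
      using c_sum by simp
  qed
  then have "k \<in> {i. i \<le> n \<and> c i = 0}"
    using Max Max_in[of "{i. i \<le> n \<and> c i = 0}"] by auto
  then have k: "k \<le> n" "c k = 0"
    by auto
  have c_above: "c i \<noteq> 0" if "i \<le> n" "k < i" for i
    using Max Max_ge[of "{i. i \<le> n \<and> c i = 0}" i] that by auto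
  obtain E where E: "E \<in> subdivision ?P ?\<theta>" "C \<subseteq> E"
      "\<forall>i\<le>n. component n P \<rho> C i \<subseteq> component n P \<theta> E i"
    using coarser C_sub unfolding coarser_def mixed_subdivision_def by blast
  have "D = E"
    using uniq[OF C_sub xC _ xD E(1,2)] D by (auto simp: n_cells_def mixed_subdivision_def)
  then have sub: "cell (P i) (\<rho> i) v \<subseteq> ?D i" if "i \<le> n" for i
    using E(3) comp that by auto
  have D_comp: "?D i = cell (P i) (\<theta> i) d" if "i \<le> n" for i
    unfolding d by (rule component_cell[OF \<theta> that])
  define e where "e i = aff_dim (?D i)" for i
  have c_le: "c i \<le> e i" if "i \<le> n" for i
    unfolding c_def e_def by (rule aff_dim_subset[OF sub[OF that]])
  have split: "{..n} = {..<k} \<union> {k..n}"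
    using k(1) by auto
  have "C = (\<Sum>i\<le>n. cell (P i) (\<rho> i) v)"
    unfolding C_def by (rule cell_inf_conv_eq_sum[OF \<rho>])
  also have "\<dots> = (\<Sum>i<k. cell (P i) (\<rho> i) v) + (\<Sum>i\<in>{k..n}. cell (P i) (\<rho> i) v)"
    unfolding split by (rule sum.union_disjoint) auto
  finally have C_split: "C = (\<Sum>i<k. cell (P i) (\<rho> i) v) + (\<Sum>i\<in>{k..n}. cell (P i) (\<rho> i) v)" .
  (* C fills n dimensions, which bounds from below the dimensions of its first k components together
     with that of the remaining sum; regrouped tightness of D gives the matching upper bound. *)
  have "int n = aff_dim C"
    using C_cell by (simp add: n_cells_def)
  also have "\<dots> \<le> aff_dim (\<Sum>i<k. cell (P i) (\<rho> i) v) + aff_dim (\<Sum>i\<in>{k..n}. cell (P i) (\<rho> i) v)"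
    unfolding C_split using nonempty k(1)
    by (intro aff_dim_set_plus_le set_sum_nonempty) auto
  also have "aff_dim (\<Sum>i<k. cell (P i) (\<rho> i) v) \<le> (\<Sum>i<k. c i)"
    unfolding c_def using nonempty k(1) by (intro aff_dim_set_sum_le) auto
  also have "aff_dim (\<Sum>i\<in>{k..n}. cell (P i) (\<rho> i) v) \<le> aff_dim (\<Sum>i\<in>{k..n}. ?D i)"
    using sub by (intro aff_dim_subset set_sum_subset) auto
  finally have "(\<Sum>i<k. e i) \<le> (\<Sum>i<k. c i)"
    using D_tight unfolding e_def by linarith
  moreover have "(\<Sum>i<k. c i) \<le> (\<Sum>i<k. e i)"
    using c_le k(1) by (intro sum_mono) auto
  ultimately have "c i = e i" if "i < k" for i
    using sum_mono_inv[of c "{..<k}" e i] c_le k(1) that by force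
  then have c_below: "c i \<noteq> 0" if "i < k" for i
    using D_pos[of i] that k(1) by (simp add: e_def)
  have c_ge: "1 \<le> c i" if "i \<le> n" "i \<noteq> k" for i
    using c_nonneg[OF that(1)] c_below[of i] c_above[of i] that by (cases "i < k") force+
  have "(\<Sum>i\<in>{..n} - {k}. c i) = int n"
    using c_sum k sum.remove[of "{..n}" k c] by simp
  also have "int n = (\<Sum>i\<in>{..n} - {k}. 1)"
    using k(1) by simp
  finally have c_one: "c i = 1" if "i \<le> n" "i \<noteq> k" for i
    using sum_mono_inv[of "\<lambda>_. 1" "{..n} - {k}" c i] c_ge that by force
  have D_poly: "polytopal_function (?D i) (\<rho> i)" if i: "i \<le> n" for i
  proof (rule polytopal_function_restrict[OF \<rho>[OF i]])
    show "polytope (?D i)" "?D i \<noteq> {}"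
      unfolding D_comp[OF i] using cell_nonempty[OF \<theta>[OF i]] polytope_cell[OF \<theta>[OF i]] by auto
    show "?D i \<subseteq> P i"
      unfolding D_comp[OF i] by (auto simp: cell_def)
  qed
  have restrict: "cell (?D i) (\<rho> i) v = cell (P i) (\<rho> i) v" if i: "i \<le> n" for i
    using sub[OF i] nonempty[OF i] unfolding D_comp[OF i] by (intro cell_restrict) (auto simp: cell_def)
  have "C = (\<Sum>i\<le>n. cell (P i) (\<rho> i) v)"
    unfolding C_def by (rule cell_inf_conv_eq_sum[OF \<rho>])
  also have "\<dots> = (\<Sum>i\<le>n. cell (?D i) (\<rho> i) v)"
    using restrict by simp
  also have "\<dots> = cell (\<Sum>i\<le>n. ?D i) (inf_conv n ?D \<rho>) v"
    by (rule cell_inf_conv_eq_sum[OF D_poly, symmetric])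
  finally have C_D: "C = cell (\<Sum>i\<le>n. ?D i) (inf_conv n ?D \<rho>) v" .
  have "component n ?D \<rho> C i = cell (P i) (\<rho> i) v" if "i \<le> n" for i
    unfolding C_D restrict[OF that, symmetric] by (rule component_cell[OF D_poly that])
  then have "k_mixed n ?D \<rho> k C"
    using c_one one_dim_polytope_is_segment[OF polytope_cell[OF \<rho>]] unfolding k_mixed_def c_def
    by metis
  moreover have "C \<in> n_cells n n ?D \<rho>"
    using C_D C_cell by (auto simp: n_cells_def mixed_subdivision_def subdivision_def)
  moreover have "b \<in> translate C \<delta>"
    using xC b_eq by blast
  ultimately show ?thesis
    by blast
qed


section \<open>Admissibility of the incremental chain\<close>

theorem corollary4p25:
  fixes M :: "'v::euclidean_space set"
    and n :: nat
    and A :: "nat \<Rightarrow> 'v set"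
    and W U :: "nat \<Rightarrow> (nat \<Rightarrow> 'v \<Rightarrow> real) set"
    and \<nu> :: "nat \<Rightarrow> 'v \<Rightarrow> real"
    and \<theta> :: "nat \<Rightarrow> nat \<Rightarrow> 'v \<Rightarrow> real"
    and \<Delta> :: "nat \<Rightarrow> 'v set"
    and \<delta> :: 'v
  assumes "lattice_of_rank n M"
    and "\<And>i. i \<le> n \<Longrightarrow> finite (A i) \<and> A i \<noteq> {} \<and> A i \<subseteq> M"
    and \<Delta>_def: "\<Delta> = (\<lambda>i. convex hull (A i))"
    and "\<And>i. i < n \<Longrightarrow> finite_union_of_hyperplanes i A (W i)"
    and "\<And>i \<nu>' B. i < n \<Longrightarrow> \<nu>' \<notin> W i \<Longrightarrow>
           B = (\<lambda>j. if j \<le> i then A j else (\<Sum>l\<in>{i<..n}. A l)) \<Longrightarrow>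
           tight n (Suc i) (\<lambda>j. convex hull (B j)) (\<lambda>j. lower_hull (B j) (zero_from (Suc i) \<nu>' j))"
    and "\<And>i. i < n \<Longrightarrow> \<nu> \<notin> W i"
    and "\<And>i. i < n \<Longrightarrow> lifting_neighborhood n A (zero_from i \<nu>) (U i)"
    and "\<And>i \<nu>'. i < n \<Longrightarrow> \<nu>' \<in> U i \<Longrightarrow>
           coarser n \<Delta> (\<lambda>j. lower_hull (A j) (zero_from i \<nu> j)) (\<lambda>j. lower_hull (A j) (\<nu>' j))"
    and "\<And>i. i < n \<Longrightarrow> zero_from (Suc i) \<nu> \<in> U i"
    and \<theta>_def: "\<theta> = (\<lambda>k i. if i < k then lower_hull (A i) (\<nu> i) else (\<lambda>_. 0))"
    and "generic_translation M n \<Delta> (\<theta> n) \<delta>"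
  shows "incremental_chain n \<Delta> \<theta> \<and> admissible M n A (\<theta> n) \<delta> \<theta>"
proof -
  have A: "finite (A i)" "A i \<noteq> {}" "A i \<subseteq> M" if "i \<le> n" for i
    using assms(2)[OF that] by auto
  have lower_hull_\<theta>: "lower_hull (A i) (zero_from k \<nu> i) x = \<theta> k i x" if "i \<le> n" "x \<in> \<Delta> i" for k i x
  proof (cases "i < k")
    case True
    then have "zero_from k \<nu> i = \<nu> i"
      by (auto simp: zero_from_def)
    with True show ?thesis
      by (simp add: \<theta>_def)
  next
    case False
    then have "zero_from k \<nu> i = (\<lambda>_. 0)"
      by (auto simp: zero_from_def)
    with False show ?thesis
      using lower_hull_zero[OF A(1)[OF that(1)], of x] that(2) by (simp add: \<theta>_def \<Delta>_def)
  qed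
  have poly: "polytopal_function (\<Delta> i) (\<theta> k i)" if i: "i \<le> n" for k i
  proof (rule polytopal_function_cong[OF _ lower_hull_\<theta>[OF i]])
    show "polytopal_function (\<Delta> i) (lower_hull (A i) (zero_from k \<nu> i))"
      unfolding \<Delta>_def using A[OF i] by (intro polytopal_function_lower_hull) auto
  qed
  have \<theta>_zero: "\<theta> k i x = 0" if "k \<le> i" for k i x
    using that by (simp add: \<theta>_def)
  have step: "coarser n \<Delta> (\<theta> k) (\<theta> (Suc k))" if k: "k < n" for k
  proof -
    have "coarser n \<Delta> (\<lambda>j. lower_hull (A j) (zero_from k \<nu> j))
        (\<lambda>j. lower_hull (A j) (zero_from (Suc k) \<nu> j))"
      using assms(8)[OF k assms(9)[OF k]] .
    moreover have "coarser n \<Delta> (\<lambda>j. lower_hull (A j) (zero_from k \<nu> j))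
        (\<lambda>j. lower_hull (A j) (zero_from (Suc k) \<nu> j)) = coarser n \<Delta> (\<theta> k) (\<theta> (Suc k))"
      by (rule coarser_cong) (simp_all add: lower_hull_\<theta>)
    ultimately show ?thesis
      by blast
  qed
  have coarser_last: "coarser n \<Delta> (\<theta> k) (\<theta> n)" if "k \<le> n" for k
    using that
  proof (induction rule: inc_induct)
    case base
    show ?case
      by (rule coarser_refl)
  next
    case (step k)
    show ?case
      by (rule coarser_trans[OF \<open>\<And>k. k < n \<Longrightarrow> coarser n \<Delta> (\<theta> k) (\<theta> (Suc k))\<close>[OF step.hyps(2)] step.IH])
  qed
  have chain: "incremental_chain n \<Delta> \<theta>"
    unfolding incremental_chain_def
    using poly step \<theta>_zero polytopal_function_imp_convex_piecewise_affine by blast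
  have grouped_tight: "(\<Sum>i<k. aff_dim (component n \<Delta> (\<theta> k) D i))
      + aff_dim (\<Sum>i\<in>{k..n}. component n \<Delta> (\<theta> k) D i) = int n"
    if k: "k \<le> n" and D: "D \<in> n_cells n n \<Delta> (\<theta> k)" for k D
  proof (cases k)
    (* For k = 0 all supports are merged, and the claim is that D itself has dimension n. *)
    case 0
    obtain d where d: "D = cell (\<Sum>i\<le>n. \<Delta> i) (inf_conv n \<Delta> (\<theta> k)) d"
      using D by (auto simp: n_cells_def mixed_subdivision_def subdivision_def)
    have "component n \<Delta> (\<theta> k) D i = cell (\<Delta> i) (\<theta> k i) d" if "i \<le> n" for i
      unfolding d by (rule component_cell[OF poly that])
    then have "(\<Sum>i\<le>n. component n \<Delta> (\<theta> k) D i) = (\<Sum>i\<le>n. cell (\<Delta> i) (\<theta> k i) d)"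
      by (intro sum.cong) auto
    also have "\<dots> = D"
      unfolding d by (rule cell_inf_conv_eq_sum[OF poly, symmetric])
    finally show ?thesis
      using D 0 by (simp add: n_cells_def atLeast0AtMost)
  next
    case (Suc i)
    define B where "B = (\<lambda>j. if j \<le> i then A j else (\<Sum>l\<in>{i<..n}. A l))"
    have i: "i < n"
      using k Suc by simp
    have "{i<..n} = {k..n}"
      using Suc by auto
    then have Bk: "B k = (\<Sum>l\<in>{k..n}. A l)"
      using Suc by (simp add: B_def)
    have Bj: "B j = A j" if "j < k" for j
      using that Suc by (simp add: B_def)
    have "finite (B k)"
      unfolding Bk using A(1) by (intro finite_set_sum) auto
    have "zero_from (Suc i) \<nu> k = (\<lambda>_. 0)"
      using Suc by (auto simp: zero_from_def)
    then have zero: "lower_hull (B k) (zero_from (Suc i) \<nu> k) x = 0" if "x \<in> convex hull (B k)" for x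
      using lower_hull_zero[OF \<open>finite (B k)\<close> that] by simp
    have low: "lower_hull (B j) (zero_from (Suc i) \<nu> j) x = \<theta> k j x" if "j < k" "x \<in> \<Delta> j" for j x
      using lower_hull_\<theta>[of j x k] that k Suc by (simp add: Bj)
    have "tight n k (\<lambda>j. convex hull (B j)) (\<lambda>j. lower_hull (B j) (zero_from (Suc i) \<nu> j))"
      using assms(5)[OF i assms(6)[OF i] B_def] Suc by simp
    then show ?thesis
      using D k \<theta>_zero low zero Bj
      by (intro tight_regroup[where P' = "\<lambda>j. convex hull (B j)"]) 
        (auto simp: poly[unfolded \<Delta>_def] \<Delta>_def Bk convex_hull_set_sum)
  qed
  (* Grouping at k = n merges only the last support with itself. *)
  have tight: "tight n n \<Delta> (\<theta> n)"
    unfolding tight_def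
  proof
    fix C assume "C \<in> n_cells n n \<Delta> (\<theta> n)"
    from grouped_tight[OF order_refl this]
    show "(\<Sum>i\<le>n. aff_dim (component n \<Delta> (\<theta> n) C i)) = int n"
      by (simp add: lessThan_Suc_atMost[symmetric])
  qed
  have dim: "dim (span M) = n"
    using assms(1) by (rule dim_span_lattice)
  have \<Delta>_M: "\<Delta> i \<subseteq> span M" if "i \<le> n" for i
    unfolding \<Delta>_def using A(3)[OF that] by (intro hull_minimal) (auto simp: subspace_imp_convex span_base)
  have alternatives: "card (fundamental_indices M n (\<lambda>i. A i \<inter> component n \<Delta> (\<theta> k) D i)) \<le> 1 \<or>
      lattice_points_of_index M n \<Delta> (\<theta> n) \<delta> k \<inter> translate D \<delta> \<subseteq>
        \<Union>{translate C \<delta> | C. C \<in> n_cells n n (component n \<Delta> (\<theta> k) D) (\<theta> n) \<and>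
             k_mixed n (component n \<Delta> (\<theta> k) D) (\<theta> n) k C}"
    if k: "k \<le> n" and D: "D \<in> n_cells n n \<Delta> (\<theta> k)" for k D
  proof (cases "\<exists>i\<le>n. i < k \<and> aff_dim (component n \<Delta> (\<theta> k) D i) = 0")
    case True
    then obtain i a where "i \<le> n" "component n \<Delta> (\<theta> k) D i = {a}"
      by (auto simp: aff_dim_eq_0)
    then have "fundamental_indices M n (\<lambda>i. A i \<inter> component n \<Delta> (\<theta> k) D i) = {}"
      using A(3) by (intro fundamental_indices_eq_empty[of i n _ a]) auto
    then show ?thesis
      by simp
  next
    case False
    have "\<exists>C \<in> n_cells n n (component n \<Delta> (\<theta> k) D) (\<theta> n).
        k_mixed n (component n \<Delta> (\<theta> k) D) (\<theta> n) k C \<and> b \<in> translate C \<delta>"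
      if "b \<in> lattice_points_of_index M n \<Delta> (\<theta> n) \<delta> k" "b \<in> translate D \<delta>" for b
    proof (rule index_points_lie_in_mixed_cells[OF dim \<Delta>_M poly poly assms(11) tight
          coarser_last[OF k] D _ _ that])
    qed (use grouped_tight[OF k D] False in auto)
    then show ?thesis
      by blast
  qed
  have "admissible M n A (\<theta> n) \<delta> \<theta>"
    unfolding admissible_def Let_def \<Delta>_def[symmetric]
    using lower_hull_\<theta> tight chain coarser_last[OF order_refl] alternatives
    by (intro conjI exI[of _ "zero_from n \<nu>"] allI impI ballI) (auto simp: \<Delta>_def)
  with chain show ?thesis
    by blast
qed

end
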